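(* (i) For every oriented graph $G^\sigma$ with $n$ vertices, $m\ge1$ arcs and maximum degree $\Delta$, $$1-\frac{2m}{2m+n(n-1)|\det(S(G^\sigma))|^{2/n}}\le I_S^1(G^\sigma)\le 1-\frac1n\le 1-\frac{2m}{n^2\Delta}.$$ (ii) Let $T^\sigma$ be an oriented tree of order $n\ge2$ with underlying tree $T_n$. Then $$I_S^1(S_n^\sigma)\le I_S^1(T^\sigma)\le I_S^1(P_n^\sigma),$$ where $S_n^\sigma$ and $P_n^\sigma$ denote an oriented star and an oriented path of order $n$, with any orientation, respectively. Equality holds (in at least one of the two inequalities) if and only if $T_n\cong S_n$ or $T_n\cong P_n$, where $S_n$ and $P_n$ are the undirected star and path of order $n$.
   Context: $G$ is a finite simple undirected graph with vertices $v_1,\dots,v_n$, and $G^\sigma$ is the oriented graph obtained from $G$ by an orientation $\sigma$ (each edge receives one direction); the maximum degree is that of the underlying graph $G$. The skew adjacency matrix is the $n\times n$ matrix $S(G^\sigma)=[s_{ij}]$ with $s_{ij}=1$ and $s_{ji}=-1$ if $\langle v_i,v_j\rangle$ is an arc of $G^\sigma$, and $s_{ij}=s_{ji}=0$ if there is no arc between $v_i$ and $v_j$. Let $\lambda_1,\dots,\lambda_n$ be its (complex) eigenvalues, $p_i=|\lambda_i|/\sum_{j=1}^n|\lambda_j|$, and $I_S^1(G^\sigma)=\sum_{i=1}^n p_i(1-p_i)$. An oriented tree is an orientation of a tree. *)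

theory Defs
  imports
    "Jordan_Normal_Form.Char_Poly"
    "Graph_Theory.Digraph_Isomorphism"
    "Graph_Theory.Pair_Digraph"
    "HOL-Library.Multiset"
begin

text \<open>
  Finite simple undirected graphs are the symmetric loop-free digraphs of
  \<^theory>\<open>Graph_Theory.Pair_Digraph\<close>; the underlying graph of an oriented graph \<open>D\<close> is
  \<^term>\<open>mk_symmetric (with_proj D)\<close>.
\<close>

locale oriented_graph = pair_digraph D for D :: "'a pair_pre_digraph" +
  assumes one_direction: "(u, v) \<in> parcs D \<Longrightarrow> (v, u) \<notin> parcs D"

abbreviation underlying :: "'a pair_pre_digraph \<Rightarrow> 'a pair_pre_digraph" where
  "underlying D \<equiv> mk_symmetric (with_proj D)"

text \<open>In a symmetric digraph the out-degree of a vertex counts its neighbours.\<close>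

definition max_degree :: "'a pair_pre_digraph \<Rightarrow> nat" where
  "max_degree G = Max ((\<lambda>v. out_degree (with_proj G) v) ` pverts G)"

text \<open>
  The library's \<^const>\<open>Digraph_Component.tree\<close> forbids directed cycles, including the closed walk
  \<open>u, v, u\<close> that every edge of a symmetric digraph gives rise to. A cycle of a simple undirected
  graph has length at least 3.
\<close>

definition undirected_tree :: "'a pair_pre_digraph \<Rightarrow> bool" where
  "undirected_tree G \<longleftrightarrow>
     Digraph_Component.connected (with_proj G) \<and>
     \<not> (\<exists>p. pre_digraph.cycle (with_proj G) p \<and> length p \<ge> 3)"

definition star_graph :: "nat \<Rightarrow> nat pair_pre_digraph" where
  "star_graph n = \<lparr> pverts = {..<n},
     parcs = {(i, j). i < n \<and> j < n \<and> i \<noteq> j \<and> (i = 0 \<or> j = 0)} \<rparr>"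

definition path_graph :: "nat \<Rightarrow> nat pair_pre_digraph" where
  "path_graph n = \<lparr> pverts = {..<n},
     parcs = {(i, j). i < n \<and> j < n \<and> (j = i + 1 \<or> i = j + 1)} \<rparr>"

abbreviation graph_iso :: "'a pair_pre_digraph \<Rightarrow> 'b pair_pre_digraph \<Rightarrow> bool" (infix "\<cong>\<^sub>G" 50) where
  "G \<cong>\<^sub>G H \<equiv> digraph_iso (with_proj G) (with_proj H)"

text \<open>The list \<open>vs\<close> is the numbering \<open>v\<^sub>1, \<dots>, v\<^sub>n\<close> of the vertices.\<close>

definition vertex_numbering :: "'a list \<Rightarrow> 'a pair_pre_digraph \<Rightarrow> bool" where
  "vertex_numbering vs D \<longleftrightarrow> distinct vs \<and> set vs = pverts D"

definition skew_adj_mat :: "'a list \<Rightarrow> 'a pair_pre_digraph \<Rightarrow> complex mat" where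
  "skew_adj_mat vs D = mat (length vs) (length vs) (\<lambda>(i, j).
     if (vs ! i, vs ! j) \<in> parcs D then 1
     else if (vs ! j, vs ! i) \<in> parcs D then - 1
     else 0)"

text \<open>Eigenvalues are counted with algebraic multiplicity.\<close>

definition skew_eigenvalues :: "'a list \<Rightarrow> 'a pair_pre_digraph \<Rightarrow> complex multiset" where
  "skew_eigenvalues vs D = proots (char_poly (skew_adj_mat vs D))"

text \<open>The weights \<open>p\<^sub>i\<close> as a function of the eigenvalue \<open>\<lambda>\<^sub>i\<close>.\<close>

definition skew_weight :: "'a list \<Rightarrow> 'a pair_pre_digraph \<Rightarrow> complex \<Rightarrow> real" where
  "skew_weight vs D l = cmod l / (\<Sum>k\<in>#skew_eigenvalues vs D. cmod k)"

definition I_S1 :: "'a list \<Rightarrow> 'a pair_pre_digraph \<Rightarrow> real" where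
  "I_S1 vs D = (\<Sum>l\<in>#skew_eigenvalues vs D. skew_weight vs D l * (1 - skew_weight vs D l))"

end

theory Submission
  imports
    Defs
    "HOL-Real_Asymp.Real_Asymp"
    "Jordan_Normal_Form.Schur_Decomposition"
begin

text \<open>
  The eigenvalues \<open>\<lambda>\<^sub>i\<close> of a real skew-symmetric matrix are imaginary, and the trace of its square
  gives \<open>\<Sum>|\<lambda>\<^sub>i|\<^sup>2 = 2 m\<close>. Writing \<open>E = \<Sum>|\<lambda>\<^sub>i|\<close> for the skew energy, the entropy is therefore
  \<open>1 - 2 m / E\<^sup>2\<close> (lemma \<open>I_S1_eq\<close>), so every claim is a claim about \<open>E\<close>.

  For a general oriented graph, the Cauchy-Schwarz inequality bounds \<open>E\<^sup>2\<close> from above by \<open>2 m n\<close>, and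
  the arithmetic-geometric mean inequality applied to the mixed products \<open>|\<lambda>\<^sub>i| |\<lambda>\<^sub>j|\<close> bounds it from
  below in terms of the determinant (lemma \<open>sum_square_ge_geometric_mean\<close>). The bound with the maximum
  degree is the handshake inequality \<open>2 m \<le> n \<Delta>\<close>.

  For trees with the same number of vertices, \<open>m\<close> is fixed and energies have to be compared. At a real
  point \<open>t\<close> the squared characteristic polynomial is \<open>\<Prod>(t\<^sup>2 + |\<lambda>\<^sub>i|\<^sup>2)\<close>, and the energy is, up to the
  factor \<open>\<pi>\<close>, the integral of \<open>\<Sum>ln (1 + |\<lambda>\<^sub>i|\<^sup>2 / t\<^sup>2)\<close> over \<open>t > 0\<close>. Hence a pointwise inequality between
  characteristic polynomials on \<open>t > 0\<close> implies one between energies, and strictness is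
  preserved (lemma \<open>sum_mset_le_if_prod_le\<close>).

  The pointwise inequalities follow from one recursion. If \<open>v\<close> is a leaf with neighbour \<open>u\<close>, expanding
  the determinant along \<open>v\<close> gives \<open>\<phi>(V) = t \<phi>(V - {v}) + \<phi>(V - {v, u})\<close>, independently of the
  orientation (lemma \<open>char_det_leaf\<close>). The values on paths satisfy exactly this recursion, and an
  induction over all forests bounds \<open>\<phi>(V)\<close> by the value of the path of the same order, with equality
  only for paths (lemma \<open>char_det_forest_le\<close>). In the other direction, \<open>\<phi>(V - {v, u})\<close> is at least the
  power of \<open>t\<close> that an edgeless graph has, which yields the value of the star as a lower bound, with equality
  only for stars (lemma \<open>char_det_forest_ge\<close>). It remains to translate between the
  combinatorial notions used in the inductions and the graph-theoretic ones: absence of cycles becomes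
  the existence of a vertex of degree at most one in every nonempty vertex set (lemma
  \<open>cycle_if_min_degree_2\<close>), and stars and paths are recognised up to isomorphism.
\<close>

section \<open>Comparing sums of roots through an integral of Coulson type\<close>

text \<open>
  The derivative in \<open>t\<close> is \<open>ln (1 + (a / t)\<^sup>2)\<close>, so this is the antiderivative behind the integral
  of \<open>ln (1 + (a / t)\<^sup>2)\<close> over the positive half-line, whose value is \<open>\<pi> a\<close>. For \<open>a = 0\<close> it is
  constantly \<open>0\<close>, because \<open>t / 0 = 0\<close>.
\<close>

definition coulson_primitive :: "real \<Rightarrow> real \<Rightarrow> real" where
  "coulson_primitive a t = t * ln (1 + (a / t)\<^sup>2) + 2 * a * arctan (t / a)"

lemma coulson_primitive_has_derivative:
  assumes "a \<ge> 0" "t > 0"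
  shows "(coulson_primitive a has_real_derivative ln (1 + (a / t)\<^sup>2)) (at t)"
proof (cases "a = 0")
  case True
  then show ?thesis by (simp add: coulson_primitive_def[abs_def])
next
  case False
  then have a: "a > 0" using assms by simp
  have pos: "a\<^sup>2 + t\<^sup>2 > 0" using a by (simp add: add_pos_nonneg)
  have e1: "1 + (a / t)\<^sup>2 = (a\<^sup>2 + t\<^sup>2) / t\<^sup>2" and e2: "1 + (t / a)\<^sup>2 = (a\<^sup>2 + t\<^sup>2) / a\<^sup>2"
    using a assms(2) by (auto simp: field_simps)
  have nz: "1 + (a / t)\<^sup>2 > 0"
    unfolding e1 using pos assms(2) by simp
  have d: "((\<lambda>t. 1 + (a / t)\<^sup>2) has_real_derivative - 2 * a\<^sup>2 / t ^ 3) (at t)"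
    using assms(2) by (auto intro!: derivative_eq_intros simp: field_simps power2_eq_square power3_eq_cube)
  have d1: "((\<lambda>t. t * ln (1 + (a / t)\<^sup>2)) has_real_derivative
      ln (1 + (a / t)\<^sup>2) + t * (- 2 * a\<^sup>2 / t ^ 3 / (1 + (a / t)\<^sup>2))) (at t)"
    using DERIV_mult[OF DERIV_ident DERIV_chain2[OF DERIV_ln[OF nz] d]]
    by (simp add: divide_inverse mult_ac)
  have d2: "((\<lambda>t. 2 * a * arctan (t / a)) has_real_derivative
      2 * a * (inverse (1 + (t / a)\<^sup>2) * (1 / a))) (at t)"
    using a by (auto intro!: derivative_eq_intros)
  have "t * (- 2 * a\<^sup>2 / t ^ 3 / (q / t\<^sup>2)) = - 2 * a\<^sup>2 / q" if "q > 0" for q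
    using assms(2) that by (simp add: field_simps power2_eq_square power3_eq_cube)
  then have "t * (- 2 * a\<^sup>2 / t ^ 3 / (1 + (a / t)\<^sup>2)) = - 2 * a\<^sup>2 / (a\<^sup>2 + t\<^sup>2)"
    unfolding e1 using pos by blast
  moreover have "2 * a * (inverse (q / a\<^sup>2) * (1 / a)) = 2 * a\<^sup>2 / q" if "q > 0" for q
    using a that by (simp add: field_simps)
  then have "2 * a * (inverse (1 + (t / a)\<^sup>2) * (1 / a)) = 2 * a\<^sup>2 / (a\<^sup>2 + t\<^sup>2)"
    unfolding e2 using pos by blast
  ultimately show ?thesis
    using DERIV_add[OF d1 d2] unfolding coulson_primitive_def[abs_def] by simp
qed

lemma coulson_primitive_at_0:
  assumes "a \<ge> 0"
  shows "(coulson_primitive a \<longlongrightarrow> 0) (at_right 0)"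
proof (cases "a = 0")
  case False
  then have "a > 0" using assms by simp
  then show ?thesis unfolding coulson_primitive_def[abs_def] by real_asymp
qed (simp add: coulson_primitive_def[abs_def])

lemma coulson_primitive_at_top:
  assumes "a \<ge> 0"
  shows "(coulson_primitive a \<longlongrightarrow> pi * a) at_top"
proof (cases "a = 0")
  case False
  then have "a > 0" using assms by simp
  then show ?thesis unfolding coulson_primitive_def[abs_def] by real_asymp
qed (simp add: coulson_primitive_def[abs_def])

lemma sum_coulson_primitive_has_derivative:
  assumes "\<forall>a\<in>#A. a \<ge> 0" "t > 0"
  shows "((\<lambda>t. \<Sum>a\<in>#A. coulson_primitive a t) has_real_derivative
           ln (\<Prod>a\<in>#A. t\<^sup>2 + a\<^sup>2) - real (size A) * ln (t\<^sup>2)) (at t)"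
  using assms(1)
proof (induction A)
  case (add a A)
  have pos: "t\<^sup>2 + b\<^sup>2 > 0" for b :: real
    using assms(2) by (simp add: add_pos_nonneg)
  then have P: "(\<Prod>a\<in>#A. t\<^sup>2 + a\<^sup>2) > 0"
    by (induction A) auto
  have "1 + (a / t)\<^sup>2 = (t\<^sup>2 + a\<^sup>2) / t\<^sup>2"
    using assms(2) by (simp add: field_simps)
  then have "ln (1 + (a / t)\<^sup>2) = ln (t\<^sup>2 + a\<^sup>2) - ln (t\<^sup>2)"
    using pos[of a] assms(2) by (simp add: ln_div)
  moreover have "ln ((t\<^sup>2 + a\<^sup>2) * (\<Prod>a\<in>#A. t\<^sup>2 + a\<^sup>2)) = ln (t\<^sup>2 + a\<^sup>2) + ln (\<Prod>a\<in>#A. t\<^sup>2 + a\<^sup>2)"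
    by (intro ln_mult_pos pos P)
  moreover have "real (size (add_mset a A)) * ln (t\<^sup>2) = ln (t\<^sup>2) + real (size A) * ln (t\<^sup>2)"
    by (simp add: distrib_right)
  ultimately show ?case
    using DERIV_add[OF coulson_primitive_has_derivative[of a t] add.IH] add.prems assms(2)
    by (simp add: add_diff_eq diff_add_eq diff_diff_eq)
qed simp

lemma tendsto_sum_mset:
  fixes f :: "'a \<Rightarrow> 'b \<Rightarrow> real"
  assumes "\<And>a. a \<in># A \<Longrightarrow> (f a \<longlongrightarrow> l a) F"
  shows "((\<lambda>t. \<Sum>a\<in>#A. f a t) \<longlongrightarrow> (\<Sum>a\<in>#A. l a)) F"
  using assms by (induction A) (auto intro!: tendsto_add)

text \<open>
  Let \<open>H\<close> be the sum of the primitives over \<open>B\<close> minus the sum over \<open>A\<close>. Its derivative is the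
  logarithm of the quotient of the two products, because the powers of \<open>t\<close> cancel when \<open>A\<close> and \<open>B\<close>
  have the same size. Hence \<open>H\<close> increases from its limit \<open>0\<close> at \<open>0\<close> to its limit
  \<open>\<pi> (sum_mset B - sum_mset A)\<close> at infinity. Working with the primitive keeps improper integrals
  out of the argument.
\<close>

lemma sum_mset_le_if_prod_le:
  fixes A B :: "real multiset"
  assumes A: "\<forall>a\<in>#A. a \<ge> 0" and B: "\<forall>b\<in>#B. b \<ge> 0" and size: "size A = size B"
    and le: "\<And>t. t > 0 \<Longrightarrow> (\<Prod>a\<in>#A. t\<^sup>2 + a\<^sup>2) \<le> (\<Prod>b\<in>#B. t\<^sup>2 + b\<^sup>2)"
  shows "sum_mset A \<le> sum_mset B"
    and "(\<And>t. t > 0 \<Longrightarrow> (\<Prod>a\<in>#A. t\<^sup>2 + a\<^sup>2) < (\<Prod>b\<in>#B. t\<^sup>2 + b\<^sup>2)) \<Longrightarrow> sum_mset A < sum_mset B"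
proof -
  define H where "H t = (\<Sum>b\<in>#B. coulson_primitive b t) - (\<Sum>a\<in>#A. coulson_primitive a t)" for t
  define h where "h t = ln (\<Prod>b\<in>#B. t\<^sup>2 + b\<^sup>2) - ln (\<Prod>a\<in>#A. t\<^sup>2 + a\<^sup>2)" for t
  have pos: "(\<Prod>a\<in>#C. t\<^sup>2 + a\<^sup>2) > 0" if "t > 0" for t and C :: "real multiset"
  proof (induction C)
    case (add c C)
    have "t\<^sup>2 + c\<^sup>2 > 0" using that by (simp add: add_pos_nonneg)
    with add show ?case by simp
  qed simp
  have deriv: "(H has_real_derivative h t) (at t)" if "t > 0" for t
    using DERIV_diff[OF sum_coulson_primitive_has_derivative[OF B that]
        sum_coulson_primitive_has_derivative[OF A that]] size
    unfolding H_def h_def by simp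
  have h: "h t \<ge> 0" if "t > 0" for t
    using le[OF that] pos[OF that] unfolding h_def by simp
  have mono: "H s \<le> H t" if "0 < s" "s \<le> t" for s t
    using that deriv h by (intro DERIV_nonneg_imp_nondecreasing[OF that(2)]) (meson less_le_trans)
  have "(H \<longlongrightarrow> (\<Sum>b\<in>#B. 0) - (\<Sum>a\<in>#A. 0)) (at_right 0)"
    unfolding H_def
    by (intro tendsto_diff tendsto_sum_mset coulson_primitive_at_0) (use A B in auto)
  then have H0: "(H \<longlongrightarrow> 0) (at_right 0)"
    by simp
  have "(H \<longlongrightarrow> (\<Sum>b\<in>#B. pi * b) - (\<Sum>a\<in>#A. pi * a)) at_top"
    unfolding H_def
    by (intro tendsto_diff tendsto_sum_mset coulson_primitive_at_top) (use A B in auto)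
  then have Hinf: "(H \<longlongrightarrow> pi * (sum_mset B - sum_mset A)) at_top"
    by (simp add: sum_mset_distrib_left algebra_simps)
  have ge: "H t \<ge> 0" if "t > 0" for t
  proof (rule tendsto_upperbound[OF H0])
    show "\<forall>\<^sub>F s in at_right 0. H s \<le> H t"
      using that mono by (auto simp: eventually_at_right_field intro!: exI[of _ t])
  qed simp
  have lim_ge: "pi * (sum_mset B - sum_mset A) \<ge> H t" if "t > 0" for t
  proof (rule tendsto_lowerbound[OF Hinf])
    show "\<forall>\<^sub>F s in at_top. H t \<le> H s"
      using eventually_ge_at_top[of t] by eventually_elim (use that mono in auto)
  qed simp
  show "sum_mset A \<le> sum_mset B"
  proof -
    have "0 \<le> pi * (sum_mset B - sum_mset A)"
      using ge[of 1] lim_ge[of 1] by simp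
    then show ?thesis using pi_gt_zero by (auto simp: zero_le_mult_iff)
  qed
  show "sum_mset A < sum_mset B"
    if "\<And>t. t > 0 \<Longrightarrow> (\<Prod>a\<in>#A. t\<^sup>2 + a\<^sup>2) < (\<Prod>b\<in>#B. t\<^sup>2 + b\<^sup>2)"
  proof -
    have h: "h t > 0" if "t > 0" for t
      using \<open>\<And>t. t > 0 \<Longrightarrow> _ t < _ t\<close>[OF that] pos[OF that] unfolding h_def by simp
    have "H 1 < H 2"
      by (rule DERIV_pos_imp_increasing) (use deriv h in force)+
    then have "0 < pi * (sum_mset B - sum_mset A)"
      using ge[of 1] lim_ge[of 2] by simp
    then show ?thesis by (simp add: zero_less_mult_iff)
  qed
qed

section \<open>Spectra of real skew-symmetric matrices\<close>

definition mat_trace :: "'a::comm_ring_1 mat \<Rightarrow> 'a" where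
  "mat_trace A = (\<Sum>i<dim_row A. A $$ (i, i))"

lemma mat_trace_mult:
  assumes "A \<in> carrier_mat n k" "B \<in> carrier_mat k n"
  shows "mat_trace (A * B) = (\<Sum>i<n. \<Sum>j<k. A $$ (i, j) * B $$ (j, i))"
  using assms by (auto simp: mat_trace_def scalar_prod_def lessThan_atLeast0 intro!: sum.cong)

lemma mat_trace_mult_commute:
  assumes "A \<in> carrier_mat n k" "B \<in> carrier_mat k n"
  shows "mat_trace (A * B) = mat_trace (B * A)"
  unfolding mat_trace_mult[OF assms] mat_trace_mult[OF assms(2,1)]
  by (subst sum.swap) (simp add: mult.commute)

text \<open>
  Triangularise \<open>A = P B Q\<close>; the trace is invariant under cyclic shifts, so \<open>A\<^sup>2\<close> and \<open>B\<^sup>2\<close> have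
  the same trace, and the diagonal of \<open>B\<^sup>2\<close> consists of the squares of the diagonal of \<open>B\<close>.
\<close>

lemma mat_trace_square_eq_sum_eigenvalues:
  fixes A :: "complex mat"
  assumes A: "A \<in> carrier_mat n n"
  shows "mat_trace (A * A) = (\<Sum>l\<in>#proots (char_poly A). l\<^sup>2)"
proof -
  obtain es where es: "char_poly A = (\<Prod>e\<leftarrow>es. [:- e, 1:])" "length es = n"
    using char_poly_factorized[OF A] by blast
  obtain B P Q where BPQ: "schur_decomposition A es = (B, P, Q)"
    by (cases "schur_decomposition A es") auto
  have sim: "similar_mat_wit A B P Q" and ut: "upper_triangular B" and diag: "diag_mat B = es"
    using schur_decomposition[OF A es(1) BPQ] by auto
  have car: "B \<in> carrier_mat n n" "P \<in> carrier_mat n n" "Q \<in> carrier_mat n n"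
    and QP: "Q * P = 1\<^sub>m n" and AB: "A = P * B * Q"
    using similar_mat_witD2[OF A sim] by auto
  have "A * A = P * (B * B * Q)"
  proof -
    have "A * A = P * B * Q * (P * B * Q)" unfolding AB ..
    also have "\<dots> = P * (B * (Q * (P * (B * Q))))"
      using car by (simp add: assoc_mult_mat[of _ n n _ n _ n])
    also have "Q * (P * (B * Q)) = (Q * P) * (B * Q)"
      using car by (simp add: assoc_mult_mat[of _ n n _ n _ n])
    also have "\<dots> = B * Q"
      using car QP by simp
    finally show ?thesis
      using car by (simp add: assoc_mult_mat[of _ n n _ n _ n])
  qed
  then have "mat_trace (A * A) = mat_trace (P * (B * B * Q))" by simp
  also have "\<dots> = mat_trace (B * B * Q * P)"
    using car by (intro mat_trace_mult_commute[of _ n n]) auto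
  also have "B * B * Q * P = B * B * (Q * P)"
    using car by (intro assoc_mult_mat[of _ n n _ n _ n]) auto
  also have "\<dots> = B * B"
    using car QP by simp
  also have "mat_trace (B * B) = (\<Sum>i<n. \<Sum>j<n. B $$ (i, j) * B $$ (j, i))"
    by (intro mat_trace_mult car)
  also have "\<dots> = (\<Sum>i<n. \<Sum>j<n. if j = i then (B $$ (i, i))\<^sup>2 else 0)"
  proof (intro sum.cong refl)
    fix i j assume "i \<in> {..<n}" "j \<in> {..<n}"
    then show "B $$ (i, j) * B $$ (j, i) = (if j = i then (B $$ (i, i))\<^sup>2 else 0)"
      using ut car unfolding upper_triangular_def
      by (cases i j rule: linorder_cases) (auto simp: power2_eq_square)
  qed
  also have "\<dots> = (\<Sum>i<n. (B $$ (i, i))\<^sup>2)"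
    by simp
  also have "\<dots> = (\<Sum>i<length es. (es ! i)\<^sup>2)"
    using car by (simp add: diag[symmetric] diag_mat_def)
  also have "\<dots> = (\<Sum>l\<leftarrow>es. l\<^sup>2)"
    by (simp add: sum_list_sum_nth lessThan_atLeast0)
  also have "\<dots> = (\<Sum>l\<in>#mset es. l\<^sup>2)"
    by (simp flip: sum_mset_sum_list mset_map)
  also have "mset es = proots (char_poly A)"
  proof -
    have "proots (\<Prod>e\<leftarrow>es. [:- e, 1:]) = mset es"
    proof (induction es)
      case (Cons e es)
      have "(\<Prod>e\<leftarrow>es. [:- e, 1:]) \<noteq> 0"
        by (auto simp: prod_list_zero_iff)
      then have "proots ([:- e, 1:] * (\<Prod>e\<leftarrow>es. [:- e, 1:])) = proots [:- e, 1:] + proots (\<Prod>e\<leftarrow>es. [:- e, 1:])"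
        by (intro proots_mult) auto
      with Cons show ?case by (simp del: mult_pCons_left)
    qed simp
    then show ?thesis using es(1) by simp
  qed
  finally show ?thesis .
qed

locale real_skew_matrix =
  fixes A :: "complex mat" and n :: nat
  assumes carrier: "A \<in> carrier_mat n n"
    and skew: "\<And>i j. i < n \<Longrightarrow> j < n \<Longrightarrow> A $$ (j, i) = - A $$ (i, j)"
    and entries_real: "\<And>i j. i < n \<Longrightarrow> j < n \<Longrightarrow> A $$ (i, j) \<in> \<real>"
begin

abbreviation eigenvalues :: "complex multiset" where
  "eigenvalues \<equiv> proots (char_poly A)"

lemma char_poly_nonzero: "char_poly A \<noteq> 0"
  using degree_monic_char_poly[OF carrier] by auto

lemma size_eigenvalues: "size eigenvalues = n"
  using degree_monic_char_poly[OF carrier] by (simp add: size_proots_complex)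

lemma poly_char_poly: "poly (char_poly A) z = (\<Prod>l\<in>#eigenvalues. z - l)"
proof -
  have "char_poly A = (\<Prod>x\<in>#eigenvalues. [:- x, 1:])"
    using complex_poly_decompose_multiset[of "char_poly A"] degree_monic_char_poly[OF carrier] by simp
  then have "poly (char_poly A) z = poly (\<Prod>x\<in>#eigenvalues. [:- x, 1:]) z"
    by (rule arg_cong)
  also have "\<dots> = (\<Prod>l\<in>#eigenvalues. z - l)"
    by (simp add: poly_prod_mset)
  finally show ?thesis .
qed

text \<open>
  The form \<open>F = v\<^sup>* A v\<close> equals \<open>l v\<^sup>* v\<close> for an eigenvector \<open>v\<close>, and skew symmetry gives
  \<open>cnj F = - F\<close>; since \<open>v\<^sup>* v\<close> is real and nonzero, \<open>cnj l = - l\<close>.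
\<close>

lemma eigenvalue_imaginary:
  assumes "l \<in># eigenvalues"
  shows "Re l = 0"
proof -
  have "eigenvalue A l"
    using assms char_poly_nonzero by (simp add: eigenvalue_root_char_poly[OF carrier])
  then obtain v where v: "v \<in> carrier_vec n" "v \<noteq> 0\<^sub>v n" "A *\<^sub>v v = l \<cdot>\<^sub>v v"
    using carrier by (auto simp: eigenvalue_def eigenvector_def)
  have row: "(\<Sum>j<n. A $$ (i, j) * v $ j) = l * v $ i" if "i < n" for i
  proof -
    have "(A *\<^sub>v v) $ i = (l \<cdot>\<^sub>v v) $ i" using v(3) by simp
    then show ?thesis using that v(1) carrier by (simp add: scalar_prod_def lessThan_atLeast0)
  qed
  define N where "N = (\<Sum>i<n. v $ i * cnj (v $ i))"
  define F where "F = (\<Sum>i<n. \<Sum>j<n. cnj (v $ i) * A $$ (i, j) * v $ j)"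
  have F1: "F = l * N"
  proof -
    have "F = (\<Sum>i<n. cnj (v $ i) * (\<Sum>j<n. A $$ (i, j) * v $ j))"
      by (simp add: F_def sum_distrib_left mult.assoc)
    also have "\<dots> = (\<Sum>i<n. l * (v $ i * cnj (v $ i)))"
      by (intro sum.cong refl) (simp add: row)
    also have "\<dots> = l * N"
      by (simp add: N_def sum_distrib_left)
    finally show ?thesis .
  qed
  have "cnj F = (\<Sum>i<n. \<Sum>j<n. v $ i * A $$ (i, j) * cnj (v $ j))"
    using entries_real by (auto simp: F_def Reals_cnj_iff intro!: sum.cong)
  also have "\<dots> = (\<Sum>j<n. \<Sum>i<n. v $ i * A $$ (i, j) * cnj (v $ j))"
    by (rule sum.swap)
  also have "\<dots> = (\<Sum>j<n. \<Sum>i<n. - (cnj (v $ j) * A $$ (j, i) * v $ i))"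
  proof (intro sum.cong refl)
    fix i j assume "j \<in> {..<n}" "i \<in> {..<n}"
    then have "A $$ (i, j) = - A $$ (j, i)" by (intro skew) auto
    then show "v $ i * A $$ (i, j) * cnj (v $ j) = - (cnj (v $ j) * A $$ (j, i) * v $ i)" by simp
  qed
  also have "\<dots> = - F"
    by (simp add: F_def sum_negf)
  finally have F2: "cnj F = - F" .
  have N: "N = of_real (\<Sum>i<n. (cmod (v $ i))\<^sup>2)"
    unfolding N_def of_real_sum complex_norm_square ..
  obtain i where i: "i < n" "v $ i \<noteq> 0"
    using v(1,2) by (metis carrier_vecD eq_vecI index_zero_vec)
  have "(\<Sum>i<n. (cmod (v $ i))\<^sup>2) \<noteq> 0"
    using i by (auto simp: sum_nonneg_eq_0_iff)
  then have N0: "N \<noteq> 0" and Nc: "cnj N = N"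
    unfolding N of_real_eq_0_iff by simp_all
  have "(cnj l + l) * N = 0"
    using F1 F2 Nc by (simp add: algebra_simps)
  then have "cnj l + l = 0" using N0 by simp
  then show ?thesis by (simp add: complex_eq_iff)
qed

text \<open>
  For imaginary \<open>l\<close> the square \<open>l\<^sup>2\<close> is \<open>- (cmod l)\<^sup>2\<close>, and skew symmetry turns the trace of \<open>A\<^sup>2\<close>
  into minus the sum of the squared entries.
\<close>

lemma sum_cmod_eigenvalues_square:
  "(\<Sum>l\<in>#eigenvalues. (cmod l)\<^sup>2) = (\<Sum>i<n. \<Sum>j<n. (cmod (A $$ (i, j)))\<^sup>2)"
proof -
  have sq: "l\<^sup>2 = - of_real ((cmod l)\<^sup>2)" if "Re l = 0" for l
    using that by (simp add: complex_eq_iff cmod_def power2_eq_square)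
  have "mat_trace (A * A) = (\<Sum>i<n. \<Sum>j<n. A $$ (i, j) * A $$ (j, i))"
    by (intro mat_trace_mult carrier)
  also have "\<dots> = (\<Sum>i<n. \<Sum>j<n. - of_real ((cmod (A $$ (i, j)))\<^sup>2))"
  proof (intro sum.cong refl)
    fix i j assume ij: "i \<in> {..<n}" "j \<in> {..<n}"
    then obtain r where r: "A $$ (i, j) = of_real r"
      using entries_real[of i j] by (auto elim: Reals_cases)
    have "A $$ (j, i) = - A $$ (i, j)" using skew[of i j] ij by simp
    with r show "A $$ (i, j) * A $$ (j, i) = - of_real ((cmod (A $$ (i, j)))\<^sup>2)"
      by (simp add: power2_eq_square)
  qed
  also have "\<dots> = - of_real (\<Sum>i<n. \<Sum>j<n. (cmod (A $$ (i, j)))\<^sup>2)"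
    by (simp add: sum_negf)
  finally have "(\<Sum>l\<in>#eigenvalues. l\<^sup>2) = - of_real (\<Sum>i<n. \<Sum>j<n. (cmod (A $$ (i, j)))\<^sup>2)"
    by (simp add: mat_trace_square_eq_sum_eigenvalues[OF carrier])
  moreover have "(\<Sum>l\<in>#eigenvalues. l\<^sup>2) = (\<Sum>l\<in>#eigenvalues. - of_real ((cmod l)\<^sup>2))"
    by (intro arg_cong[of _ _ sum_mset] image_mset_cong sq eigenvalue_imaginary)
  moreover have "(\<Sum>l\<in>#M. - of_real ((cmod l)\<^sup>2)) = (- of_real (\<Sum>l\<in>#M. (cmod l)\<^sup>2) :: complex)" for M
    by (induction M) auto
  ultimately show ?thesis
    by (metis neg_equal_iff_equal of_real_eq_iff)
qed

lemma prod_cmod_eigenvalues: "(\<Prod>l\<in>#eigenvalues. cmod l) = cmod (det A)"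
proof -
  have "- A = (- 1) \<cdot>\<^sub>m A" "char_matrix A 0 = A"
    using carrier by (auto simp: char_matrix_def)
  then have "poly (char_poly A) 0 = (- 1) ^ n * det A"
    using carrier by (simp add: char_poly_matrix[OF carrier] det_smult)
  then have "cmod (poly (char_poly A) 0) = cmod (det A)"
    by (simp add: norm_mult norm_power)
  then have "cmod (\<Prod>l\<in>#eigenvalues. 0 - l) = cmod (det A)"
    unfolding poly_char_poly .
  moreover have "cmod (\<Prod>l\<in>#M. 0 - l) = (\<Prod>l\<in>#M. cmod l)" for M
    by (induction M) (auto simp: norm_mult)
  ultimately show ?thesis by metis
qed

text \<open>
  This is where imaginary eigenvalues matter: at a real point \<open>t\<close> the modulus of the characteristic
  polynomial depends only on the moduli of the eigenvalues, so values of characteristic polynomials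
  can be fed into the comparison of sums of roots.
\<close>

lemma cmod_char_poly_square:
  "(cmod (poly (char_poly A) (of_real t)))\<^sup>2 = (\<Prod>a\<in>#image_mset cmod eigenvalues. t\<^sup>2 + a\<^sup>2)"
proof -
  have "(cmod (\<Prod>l\<in>#M. of_real t - l))\<^sup>2 = (\<Prod>l\<in>#M. t\<^sup>2 + (cmod l)\<^sup>2)" if "\<forall>l\<in>#M. Re l = 0" for M
    using that
  proof (induction M)
    case (add l M)
    then have "(cmod (of_real t - l))\<^sup>2 = t\<^sup>2 + (cmod l)\<^sup>2"
      by (simp add: cmod_power2)
    with add show ?case by (simp add: norm_mult power_mult_distrib)
  qed simp
  then show ?thesis
    using eigenvalue_imaginary by (simp add: poly_char_poly image_mset.compositionality comp_def)
qed

end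

section \<open>Determinants indexed by finite sets\<close>

text \<open>
  The determinant of the submatrix with rows and columns in \<open>V\<close>, written with the Leibniz formula.
  Indexing by sets makes the deletion of vertices a mere set difference, with no renumbering.
\<close>

definition set_det :: "('a \<Rightarrow> 'a \<Rightarrow> 'r::comm_ring_1) \<Rightarrow> 'a set \<Rightarrow> 'r" where
  "set_det M V = (\<Sum>p | p permutes V. of_int (sign p) * (\<Prod>i\<in>V. M i (p i)))"

lemma set_det_empty [simp]: "set_det M {} = 1"
  by (simp add: set_det_def)

lemma permutes_fixing_eq:
  assumes "W \<subseteq> V"
  shows "{p. p permutes V \<and> (\<forall>x\<in>V - W. p x = x)} = {p. p permutes W}"
proof safe
  fix p assume "p permutes V" "\<forall>x\<in>V - W. p x = x"
  then show "p permutes W" by (auto intro: permutes_superset)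
next
  fix p assume p: "p permutes W"
  then show "p permutes V" by (rule permutes_subset[OF _ assms])
  show "p x = x" if "x \<in> V" "x \<notin> W" for x
    using p that by (simp add: permutes_not_in)
qed

lemma sum_permutes_fixing:
  assumes "finite V" "v \<in> V"
  shows "(\<Sum>p | p permutes V \<and> p v = v. of_int (sign p) * (\<Prod>i\<in>V. M i (p i))) =
           M v v * set_det M (V - {v})"
proof -
  have "{p. p permutes V \<and> p v = v} = {p. p permutes V - {v}}"
    using permutes_fixing_eq[of "V - {v}" V] assms(2) by (auto simp: double_diff)
  moreover have "of_int (sign p) * (\<Prod>i\<in>V. M i (p i)) = M v v * (of_int (sign p) * (\<Prod>i\<in>V - {v}. M i (p i)))"
    if "p permutes V - {v}" for p
    using permutes_not_in[OF that, of v] by (simp add: prod.remove[OF assms] mult_ac)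
  ultimately show ?thesis
    by (simp add: set_det_def sum_distrib_left)
qed

lemma set_det_isolated:
  assumes "finite V" "v \<in> V" and zero: "\<And>w. w \<in> V - {v} \<Longrightarrow> M v w = 0"
  shows "set_det M V = M v v * set_det M (V - {v})"
proof -
  have "set_det M V = (\<Sum>p | p permutes V \<and> p v = v. of_int (sign p) * (\<Prod>i\<in>V. M i (p i)))"
    unfolding set_det_def
  proof (rule sum.mono_neutral_right)
    show "\<forall>p\<in>{p. p permutes V} - {p. p permutes V \<and> p v = v}. of_int (sign p) * (\<Prod>i\<in>V. M i (p i)) = 0"
    proof
      fix p assume "p \<in> {p. p permutes V} - {p. p permutes V \<and> p v = v}"
      then have "M v (p v) = 0"
        using zero assms(2) permutes_in_image[of p V v] by auto
      then have "(\<Prod>i\<in>V. M i (p i)) = 0"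
        using assms by (intro prod_zero) auto
      then show "of_int (sign p) * (\<Prod>i\<in>V. M i (p i)) = 0" by simp
    qed
  qed (use assms in \<open>auto simp: finite_permutations\<close>)
  then show ?thesis by (simp add: sum_permutes_fixing assms)
qed

text \<open>
  A permutation with a nonzero term either fixes \<open>v\<close> or exchanges \<open>v\<close> and \<open>u\<close>: otherwise \<open>v\<close> or
  its preimage meets a zero of row or column \<open>v\<close>. Removing the transposition flips the sign.
\<close>

lemma set_det_leaf:
  assumes fin: "finite V" and vu: "v \<in> V" "u \<in> V" "v \<noteq> u"
    and row: "\<And>w. w \<in> V - {v, u} \<Longrightarrow> M v w = 0"
    and col: "\<And>w. w \<in> V - {v, u} \<Longrightarrow> M w v = 0"
  shows "set_det M V = M v v * set_det M (V - {v}) - M v u * M u v * set_det M (V - {v, u})"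
proof -
  define f where "f p = of_int (sign p) * (\<Prod>i\<in>V. M i (p i))" for p
  define F where "F = {p. p permutes V \<and> p v = v}"
  define S where "S = {p. p permutes V \<and> p v = u \<and> p u = v}"
  let ?\<tau> = "Transposition.transpose v u"
  have finV: "finite {p. p permutes V}" by (rule finite_permutations[OF fin])
  have "set_det M V = sum f (F \<union> S)"
    unfolding set_det_def f_def[symmetric]
  proof (rule sum.mono_neutral_right[OF finV])
    show "\<forall>p\<in>{p. p permutes V} - (F \<union> S). f p = 0"
    proof
      fix p assume "p \<in> {p. p permutes V} - (F \<union> S)"
      then have p: "p permutes V" "p v \<noteq> v" "p v = u \<Longrightarrow> p u \<noteq> v"
        by (auto simp: F_def S_def)
      have "\<exists>i\<in>V. M i (p i) = 0"
      proof (cases "p v = u")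
        case False
        then have "M v (p v) = 0"
          using p permutes_in_image[OF p(1), of v] vu by (intro row) auto
        then show ?thesis using vu by blast
      next
        case True
        obtain w where w: "w \<in> V" "p w = v"
          using permutes_image[OF p(1)] vu(1) by (metis imageE)
        then have "M w v = 0"
          using p(2) p(3)[OF True] by (intro col) auto
        then show ?thesis using w by auto
      qed
      then have "(\<Prod>i\<in>V. M i (p i)) = 0" by (intro prod_zero[OF fin])
      then show "f p = 0" by (simp add: f_def)
    qed
  qed (auto simp: F_def S_def)
  also have "\<dots> = sum f F + sum f S"
    using finV vu(3) by (intro sum.union_disjoint) (auto simp: F_def S_def)
  also have "sum f F = M v v * set_det M (V - {v})"
    unfolding f_def F_def by (rule sum_permutes_fixing[OF fin vu(1)])
  also have "sum f S = (\<Sum>q | q permutes V - {v, u}. - (M v u * M u v) * (of_int (sign q) * (\<Prod>i\<in>V - {v, u}. M i (q i))))"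
  proof (rule sum.reindex_bij_witness[of _ "\<lambda>q. ?\<tau> \<circ> q" "\<lambda>p. ?\<tau> \<circ> p"])
    fix p assume p: "p \<in> S"
    then have pV: "p permutes V" and pv: "p v = u" "p u = v" by (auto simp: S_def)
    have "?\<tau> \<circ> p permutes V"
      using pV vu by (intro permutes_compose permutes_swap_id)
    then have "?\<tau> \<circ> p \<in> {p. p permutes V \<and> (\<forall>x\<in>V - (V - {v, u}). p x = x)}"
      using pv by auto
    then have q: "?\<tau> \<circ> p permutes V - {v, u}"
      unfolding permutes_fixing_eq[OF Diff_subset] by simp
    then show "?\<tau> \<circ> p \<in> {q. q permutes V - {v, u}}" by simp
    show "?\<tau> \<circ> (?\<tau> \<circ> p) = p" by (simp add: fun_eq_iff)
    have sg: "sign (?\<tau> \<circ> p) = - sign p"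
      using vu(3) by (simp add: sign_compose sign_swap_id permutation_swap_id permutes_imp_permutation[OF fin pV])
    have pr1: "(\<Prod>i\<in>V. M i (p i)) = M v u * M u v * (\<Prod>i\<in>V - {v, u}. M i (p i))"
    proof -
      have "(\<Prod>i\<in>V. M i (p i)) = M v (p v) * (\<Prod>i\<in>V - {v}. M i (p i))"
        by (rule prod.remove[OF fin vu(1)])
      moreover have "(\<Prod>i\<in>V - {v}. M i (p i)) = M u (p u) * (\<Prod>i\<in>V - {v} - {u}. M i (p i))"
        by (rule prod.remove) (use fin vu in auto)
      moreover have "V - {v} - {u} = V - {v, u}" by auto
      ultimately show ?thesis by (simp add: pv mult_ac)
    qed
    have pr2: "(\<Prod>i\<in>V - {v, u}. M i ((?\<tau> \<circ> p) i)) = (\<Prod>i\<in>V - {v, u}. M i (p i))"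
    proof (rule prod.cong[OF refl])
      fix i assume i: "i \<in> V - {v, u}"
      have "p i \<noteq> p v" "p i \<noteq> p u"
        using i inj_eq[OF permutes_inj[OF pV]] by simp_all
      then show "M i ((?\<tau> \<circ> p) i) = M i (p i)" by (simp add: pv)
    qed
    show "- (M v u * M u v) * (of_int (sign (?\<tau> \<circ> p)) * (\<Prod>i\<in>V - {v, u}. M i ((?\<tau> \<circ> p) i))) = f p"
      unfolding f_def sg pr1 pr2 by (simp add: mult_ac)
  next
    fix q assume "q \<in> {q. q permutes V - {v, u}}"
    then have q: "q permutes V - {v, u}" by simp
    then have "?\<tau> \<circ> q permutes V"
      using vu by (intro permutes_compose permutes_swap_id permutes_subset[OF q]) auto
    moreover have "q v = v" "q u = u" using q by (auto simp: permutes_not_in)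
    ultimately show "?\<tau> \<circ> q \<in> S" by (simp add: S_def)
    show "?\<tau> \<circ> (?\<tau> \<circ> q) = q" by (simp add: fun_eq_iff)
  qed
  also have "\<dots> = - (M v u * M u v) * set_det M (V - {v, u})"
    unfolding set_det_def sum_distrib_left ..
  finally show ?thesis by simp
qed

lemma set_det_reindex:
  assumes f: "bij_betw f A B" and fin: "finite A"
  shows "set_det M B = set_det (\<lambda>i j. M (f i) (f j)) A"
proof -
  have fA: "f ` A = B" and inj: "inj_on f A" using f by (auto simp: bij_betw_def)
  have "bij_betw (map_permutation A f) {p. p permutes A} {p. p permutes B}"
    using bij_betw_permutations[OF f]
    by (simp add: map_permutation_def[abs_def] restrict_id_def fA)
  then have "set_det M B = (\<Sum>p | p permutes A. of_int (sign (map_permutation A f p)) *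
      (\<Prod>i\<in>B. M i (map_permutation A f p i)))"
    unfolding set_det_def by (rule sum.reindex_bij_betw[symmetric])
  also have "\<dots> = set_det (\<lambda>i j. M (f i) (f j)) A"
    unfolding set_det_def
  proof (rule sum.cong[OF refl])
    fix p assume "p \<in> {p. p permutes A}"
    then have p: "p permutes A" by simp
    have sg: "sign (map_permutation A f p) = sign p"
      by (rule sign_map_permutation[OF inj p fin])
    have "(\<Prod>i\<in>B. M i (map_permutation A f p i)) = (\<Prod>i\<in>A. M (f i) (map_permutation A f p (f i)))"
      by (rule prod.reindex_bij_betw[OF f, symmetric])
    also have "\<dots> = (\<Prod>i\<in>A. M (f i) (f (p i)))"
      by (intro prod.cong refl) (simp add: map_permutation_apply[OF inj])
    finally show "of_int (sign (map_permutation A f p)) * (\<Prod>i\<in>B. M i (map_permutation A f p i)) =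
        of_int (sign p) * (\<Prod>i\<in>A. M (f i) (f (p i)))"
      by (simp only: sg)
  qed
  finally show ?thesis .
qed

lemma det_eq_set_det:
  assumes "A \<in> carrier_mat n n"
  shows "det A = set_det (\<lambda>i j. A $$ (i, j)) {0..<n}"
  using assms by (simp add: det_def' set_det_def)

lemma set_det_of_real:
  "set_det (\<lambda>i j. of_real (M i j)) V = (of_real (set_det M V) :: complex)"
  by (simp add: set_det_def)

section \<open>Forests\<close>

text \<open>
  Acyclicity in the form that inductions consume: every nonempty set of vertices has a member with
  at most one neighbour in that set. Being hereditary by definition, the property
  passes to the graphs that arise by deleting vertices, which are forests and no longer trees.
\<close>

definition forest_on :: "('a \<Rightarrow> 'a \<Rightarrow> bool) \<Rightarrow> 'a set \<Rightarrow> bool" where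
  "forest_on E V \<longleftrightarrow>
     (\<forall>W\<subseteq>V. W \<noteq> {} \<longrightarrow> (\<exists>v\<in>W. \<forall>x\<in>W. \<forall>y\<in>W. E v x \<longrightarrow> E v y \<longrightarrow> x = y))"

definition connected_on :: "('a \<Rightarrow> 'a \<Rightarrow> bool) \<Rightarrow> 'a set \<Rightarrow> bool" where
  "connected_on E V \<longleftrightarrow> (\<forall>A\<subseteq>V. A \<noteq> {} \<longrightarrow> A \<noteq> V \<longrightarrow> (\<exists>x\<in>A. \<exists>y\<in>V - A. E x y))"

text \<open>
  Every edge meets the centre \<open>c\<close>; isolated vertices are admitted, and \<open>c\<close> need not belong to \<open>V\<close>
  when there are no edges.
\<close>

definition star_on :: "('a \<Rightarrow> 'a \<Rightarrow> bool) \<Rightarrow> 'a set \<Rightarrow> bool" where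
  "star_on E V \<longleftrightarrow> (\<exists>c. \<forall>x\<in>V. \<forall>y\<in>V. E x y \<longrightarrow> x = c \<or> y = c)"

definition induced_path :: "('a \<Rightarrow> 'a \<Rightarrow> bool) \<Rightarrow> 'a list \<Rightarrow> bool" where
  "induced_path E xs \<longleftrightarrow> distinct xs \<and>
     (\<forall>i<length xs. \<forall>j<length xs. E (xs ! i) (xs ! j) \<longleftrightarrow> j = Suc i \<or> i = Suc j)"

text \<open>
  Each edge is counted in both directions.
\<close>

definition edge_pairs :: "('a \<Rightarrow> 'a \<Rightarrow> bool) \<Rightarrow> 'a set \<Rightarrow> ('a \<times> 'a) set" where
  "edge_pairs E V = {(x, y). x \<in> V \<and> y \<in> V \<and> E x y}"

lemma forest_on_subset:
  assumes "forest_on E V" "W \<subseteq> V"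
  shows "forest_on E W"
  unfolding forest_on_def
proof (intro allI impI)
  fix U assume "U \<subseteq> W" "U \<noteq> {}"
  then show "\<exists>v\<in>U. \<forall>x\<in>U. \<forall>y\<in>U. E v x \<longrightarrow> E v y \<longrightarrow> x = y"
    using assms unfolding forest_on_def by simp
qed

lemma finite_edge_pairs [simp]: "finite V \<Longrightarrow> finite (edge_pairs E V)"
  unfolding edge_pairs_def by (rule finite_subset[of _ "V \<times> V"]) auto

lemma card_remove_two:
  assumes "finite V" "v \<in> V" "u \<in> V" "v \<noteq> u"
  shows "card V = Suc (card (V - {v}))" "card (V - {v}) = Suc (card (V - {v, u}))"
proof -
  show "card V = Suc (card (V - {v}))"
    using assms by (intro card.remove)
  have "card (V - {v}) = Suc (card (V - {v} - {u}))"
    using assms by (intro card.remove) auto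
  then show "card (V - {v}) = Suc (card (V - {v, u}))"
    by (simp add: Diff_insert2[symmetric] insert_commute)
qed

lemma forest_on_cases:
  assumes "forest_on E V" "V \<noteq> {}"
  obtains (isolated) v where "v \<in> V" "\<forall>w\<in>V. \<not> E v w"
    | (leaf) v u where "v \<in> V" "u \<in> V" "E v u" "\<forall>w\<in>V. E v w \<longrightarrow> w = u"
proof -
  obtain v where v: "v \<in> V" "\<forall>x\<in>V. \<forall>y\<in>V. E v x \<longrightarrow> E v y \<longrightarrow> x = y"
    using assms unfolding forest_on_def by blast
  show thesis
  proof (cases "\<exists>u\<in>V. E v u")
    case True
    then show ?thesis using v leaf by blast
  next
    case False
    then show ?thesis using v isolated by blast
  qed
qed

text \<open>
  Membership in a set that no edge leaves is constant along the path.
\<close>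

lemma connected_on_induced_path:
  assumes "induced_path E xs"
  shows "connected_on E (set xs)"
  unfolding connected_on_def
proof (intro allI impI)
  fix A assume A: "A \<subseteq> set xs" "A \<noteq> {}" "A \<noteq> set xs"
  have edge: "E (xs ! i) (xs ! j)" if "i < length xs" "j < length xs" "j = Suc i \<or> i = Suc j" for i j
    using assms that unfolding induced_path_def by blast
  define I where "I = {i. i < length xs \<and> xs ! i \<in> A}"
  show "\<exists>x\<in>A. \<exists>y\<in>set xs - A. E x y"
  proof (rule ccontr)
    assume neg: "\<not> ?thesis"
    have step: "(xs ! i \<in> A) = (xs ! Suc i \<in> A)" if "Suc i < length xs" for i
    proof -
      have "E (xs ! i) (xs ! Suc i)" "E (xs ! Suc i) (xs ! i)" "xs ! i \<in> set xs" "xs ! Suc i \<in> set xs"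
        using edge[of i "Suc i"] edge[of "Suc i" i] that by auto
      then show ?thesis using neg by blast
    qed
    have "(xs ! i \<in> A) = (xs ! 0 \<in> A)" if "i < length xs" for i
      using that by (induction i) (use step Suc_lessD in blast)+
    then have "A = {} \<or> A = set xs"
      using A(1) by (metis in_set_conv_nth subset_antisym subsetI ex_in_conv subsetD)
    with A show False by blast
  qed
qed

locale loopfree_symmetric =
  fixes E :: "'a \<Rightarrow> 'a \<Rightarrow> bool"
  assumes sym: "E x y \<Longrightarrow> E y x" and irrefl: "\<not> E x x"
begin

lemma edge_pairs_isolated:
  assumes "v \<in> V" "\<forall>w\<in>V. \<not> E v w"
  shows "edge_pairs E V = edge_pairs E (V - {v})"
  using assms sym by (auto simp: edge_pairs_def)

lemma card_edge_pairs_leaf: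
  assumes "finite V" "v \<in> V" "u \<in> V" "E v u" "\<forall>w\<in>V. E v w \<longrightarrow> w = u"
  shows "card (edge_pairs E V) = card (edge_pairs E (V - {v})) + 2"
proof -
  have vu: "v \<noteq> u" "E u v" using assms(4) sym irrefl by blast+
  have "\<forall>w\<in>V. E w v \<longrightarrow> w = u" using assms(5) sym by blast
  then have "edge_pairs E V = insert (v, u) (insert (u, v) (edge_pairs E (V - {v})))"
    using assms vu unfolding edge_pairs_def by blast
  moreover have "(v, u) \<notin> insert (u, v) (edge_pairs E (V - {v}))" "(u, v) \<notin> edge_pairs E (V - {v})"
    using vu(1) by (simp_all add: edge_pairs_def)
  ultimately show ?thesis using assms(1) by simp
qed

text \<open>
  Deleting a vertex of degree at most one removes at most one edge.
\<close>

lemma card_edge_pairs_forest: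
  assumes "finite V" "forest_on E V" "V \<noteq> {}"
  shows "card (edge_pairs E V) + 2 \<le> 2 * card V"
  using assms
proof (induction "card V" arbitrary: V rule: less_induct)
  case less
  have IH: "card (edge_pairs E (V - {v})) + 2 \<le> 2 * card (V - {v})" if "v \<in> V" "V - {v} \<noteq> {}" for v
    using less.hyps[OF card_Diff1_less[OF less.prems(1) that(1)]] less.prems(1) that(2)
      forest_on_subset[OF less.prems(2) Diff_subset] by blast
  have card: "card V = Suc (card (V - {v}))" if "v \<in> V" for v
    using that less.prems(1) by (intro card.remove)
  from less.prems(2,3) show ?case
  proof (cases rule: forest_on_cases)
    case (isolated v)
    show ?thesis
    proof (cases "V - {v} = {}")
      case True
      have "edge_pairs E V = {}"
        unfolding edge_pairs_isolated[OF isolated] True by (simp add: edge_pairs_def)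
      then show ?thesis
        using card[OF isolated(1)] by simp
    next
      case False
      then show ?thesis
        using card[OF isolated(1)] edge_pairs_isolated[OF isolated] IH[OF isolated(1)] by simp
    qed
  next
    case (leaf v u)
    then have "V - {v} \<noteq> {}" using irrefl by blast
    then show ?thesis
      using card[OF leaf(1)] card_edge_pairs_leaf[OF less.prems(1) leaf] IH[OF leaf(1)] by linarith
  qed
qed

text \<open>
  Grow a set of vertices from a single one: connectedness supplies an edge leaving the set, and each
  new vertex contributes such an edge.
\<close>

lemma card_edge_pairs_connected:
  assumes "finite V" "connected_on E V" "V \<noteq> {}"
  shows "2 * card V \<le> card (edge_pairs E V) + 2"
proof -
  have "\<exists>W\<subseteq>V. card W = k \<and> 2 * k \<le> card (edge_pairs E W) + 2" if "1 \<le> k" "k \<le> card V" for k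
    using that
  proof (induction k rule: dec_induct)
    case base
    obtain v where "v \<in> V" using assms(3) by blast
    then show ?case by (intro exI[of _ "{v}"]) auto
  next
    case (step k)
    then obtain W where W: "W \<subseteq> V" "card W = k" "2 * k \<le> card (edge_pairs E W) + 2" by auto
    then have finW: "finite W" using assms(1) finite_subset by blast
    have "W \<noteq> {}" "W \<noteq> V" using W(2) step by auto
    then have "\<exists>x\<in>W. \<exists>y\<in>V - W. E x y"
      using assms(2)[unfolded connected_on_def] W(1) by simp
    then obtain x y where xy: "x \<in> W" "y \<in> V - W" "E x y" by blast
    have sub: "insert (x, y) (insert (y, x) (edge_pairs E W)) \<subseteq> edge_pairs E (insert y W)"
      using xy sym by (auto simp: edge_pairs_def)
    have new: "(x, y) \<notin> insert (y, x) (edge_pairs E W)" "(y, x) \<notin> edge_pairs E W"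
      using xy(1,2) by (auto simp: edge_pairs_def)
    have "card (edge_pairs E W) + 2 = card (insert (x, y) (insert (y, x) (edge_pairs E W)))"
      using new finW by simp
    also have "\<dots> \<le> card (edge_pairs E (insert y W))"
      using finW sub by (intro card_mono) auto
    finally show ?case
      using W xy finW by (intro exI[of _ "insert y W"]) auto
  qed
  moreover have "1 \<le> card V"
    using assms(1,3) by (simp add: Suc_le_eq card_gt_0_iff)
  ultimately obtain W where W: "W \<subseteq> V" "card W = card V" "2 * card V \<le> card (edge_pairs E W) + 2"
    by blast
  then have "W = V" using assms(1) by (intro card_subset_eq)
  with W show ?thesis by simp
qed

lemma card_edge_pairs_tree:
  assumes "finite V" "forest_on E V" "connected_on E V" "V \<noteq> {}"
  shows "card (edge_pairs E V) = 2 * (card V - 1)"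
  using card_edge_pairs_forest[of V] card_edge_pairs_connected[of V] assms by simp

end

section \<open>Characteristic polynomials of oriented forests\<close>

text \<open>
  The value at \<open>t\<close> of the characteristic polynomial of an oriented path with \<open>n\<close> vertices.
\<close>

fun path_char_poly :: "real \<Rightarrow> nat \<Rightarrow> real" where
  "path_char_poly t 0 = 1"
| "path_char_poly t (Suc 0) = t"
| "path_char_poly t (Suc (Suc n)) = t * path_char_poly t (Suc n) + path_char_poly t n"

lemma path_char_poly_pos: "t > 0 \<Longrightarrow> path_char_poly t n > 0"
  by (induction t n rule: path_char_poly.induct) (auto intro: add_pos_pos)

text \<open>
  A skew-symmetric function with values \<open>-1\<close>, \<open>0\<close>, \<open>1\<close> encodes an orientation of a simple graph.
\<close>

locale skew_weights =
  fixes s :: "'a \<Rightarrow> 'a \<Rightarrow> real"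
  assumes skew: "s x y = - s y x" and unit_entries: "s x y \<in> {- 1, 0, 1}"
begin

definition adj :: "'a \<Rightarrow> 'a \<Rightarrow> bool" where
  "adj x y \<longleftrightarrow> s x y \<noteq> 0"

sublocale loopfree_symmetric adj
proof
  show "adj y x" if "adj x y" for x y using that skew[of x y] unfolding adj_def by linarith
  show "\<not> adj x x" for x using skew[of x x] unfolding adj_def by linarith
qed

text \<open>
  The characteristic polynomial at \<open>t\<close> of the subgraph induced on \<open>V\<close>.
\<close>

definition char_det :: "real \<Rightarrow> 'a set \<Rightarrow> real" where
  "char_det t V = set_det (\<lambda>x y. if x = y then t else - s x y) V"

lemma char_det_empty [simp]: "char_det t {} = 1"
  by (simp add: char_det_def)

lemma char_det_isolated:
  assumes "finite V" "v \<in> V" "\<forall>w\<in>V. \<not> adj v w"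
  shows "char_det t V = t * char_det t (V - {v})"
  unfolding char_det_def
  by (subst set_det_isolated[of V v]) (use assms in \<open>auto simp: adj_def\<close>)

text \<open>
  The two entries of the edge \<open>v u\<close> have product \<open>-1\<close> whatever its direction, which is why the
  orientation is invisible in the characteristic polynomial of a forest and why the correction term
  comes with a plus sign.
\<close>

lemma char_det_leaf:
  assumes "finite V" "v \<in> V" "u \<in> V" "adj v u" "\<forall>w\<in>V. adj v w \<longrightarrow> w = u"
  shows "char_det t V = t * char_det t (V - {v}) + char_det t (V - {v, u})"
proof -
  have vu: "v \<noteq> u" using assms(4) irrefl by auto
  have "s v u * s u v = - 1"
    using assms(4) unit_entries[of v u] skew[of u v] by (auto simp: adj_def)
  moreover have "s v w = 0" "s w v = 0" if "w \<in> V - {v, u}" for w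
    using that assms(5) skew[of w v] by (auto simp: adj_def)
  ultimately show ?thesis
    unfolding char_det_def
    by (subst set_det_leaf[OF assms(1-3) vu]) (use vu in auto)
qed

lemma char_det_no_edges:
  assumes "finite V" "\<forall>x\<in>V. \<forall>y\<in>V. \<not> adj x y"
  shows "char_det t V = t ^ card V"
  using assms
proof (induction V rule: finite_induct)
  case (insert v V)
  then show ?case by (subst char_det_isolated[of _ v]) auto
qed simp

text \<open>
  The right-hand side is the value of a star with the same number of vertices and edges. Multiplying
  by \<open>t\<^sup>2\<close> avoids the truncated exponent \<open>card V - 2\<close>. Deleting a leaf \<open>v\<close> with neighbour
  \<open>u\<close> leaves the term for \<open>V - {v, u}\<close>, which contributes at least \<open>t ^ card (V - {v, u})\<close>; this
  accounts for the lost edge. If the contribution is no larger, then \<open>V - {v, u}\<close> has no edge, so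
  all edges meet \<open>u\<close>.
\<close>

lemma char_det_forest_ge:
  assumes "t > 0" "finite V" "forest_on adj V"
  shows "t\<^sup>2 * char_det t V \<ge> t ^ card V * (t\<^sup>2 + card (edge_pairs adj V) / 2)"
    and "\<not> star_on adj V \<Longrightarrow> t\<^sup>2 * char_det t V > t ^ card V * (t\<^sup>2 + card (edge_pairs adj V) / 2)"
proof -
  have "t\<^sup>2 * char_det t V \<ge> t ^ card V * (t\<^sup>2 + card (edge_pairs adj V) / 2) \<and>
    (\<not> star_on adj V \<longrightarrow> t\<^sup>2 * char_det t V > t ^ card V * (t\<^sup>2 + card (edge_pairs adj V) / 2))"
    using assms(2,3)
  proof (induction "card V" arbitrary: V rule: less_induct)
    case less
    define e where "e W = real (card (edge_pairs adj W)) / 2" for W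
    have e_nonneg: "e W \<ge> 0" for W by (simp add: e_def)
    have IH: "t\<^sup>2 * char_det t W \<ge> t ^ card W * (t\<^sup>2 + e W)"
      "\<not> star_on adj W \<Longrightarrow> t\<^sup>2 * char_det t W > t ^ card W * (t\<^sup>2 + e W)" if "W \<subset> V" for W
      using less.hyps[of W] that less.prems psubset_card_mono[OF less.prems(1) that]
        forest_on_subset[OF less.prems(2), of W] finite_subset[OF _ less.prems(1), of W]
      unfolding e_def by auto
    show ?case unfolding e_def[symmetric]
    proof (cases "V = {}")
      case True
      then show "t ^ card V * (t\<^sup>2 + e V) \<le> t\<^sup>2 * char_det t V \<and>
          (\<not> star_on adj V \<longrightarrow> t ^ card V * (t\<^sup>2 + e V) < t\<^sup>2 * char_det t V)"
        by (simp add: e_def edge_pairs_def star_on_def)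
    next
      case False
      from less.prems(2) this
      show "t ^ card V * (t\<^sup>2 + e V) \<le> t\<^sup>2 * char_det t V \<and>
          (\<not> star_on adj V \<longrightarrow> t ^ card V * (t\<^sup>2 + e V) < t\<^sup>2 * char_det t V)"
      proof (cases rule: forest_on_cases)
        case (isolated v)
        have V: "card V = Suc (card (V - {v}))" "V - {v} \<subset> V"
          using isolated(1) less.prems(1) card.remove by fastforce+
        have "e V = e (V - {v})" using edge_pairs_isolated[OF isolated] by (simp add: e_def)
        then have eq: "t ^ card V * (t\<^sup>2 + e V) = t * (t ^ card (V - {v}) * (t\<^sup>2 + e (V - {v})))"
            "t\<^sup>2 * char_det t V = t * (t\<^sup>2 * char_det t (V - {v}))"
          using char_det_isolated[OF less.prems(1) isolated, of t] V(1) by simp_all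
        have "star_on adj V" if "star_on adj (V - {v})"
          using that isolated sym unfolding star_on_def by blast
        then show ?thesis unfolding eq using IH[OF V(2)] assms(1) by auto
      next
        case (leaf v u)
        let ?W = "V - {v, u}"
        have vu: "v \<noteq> u" using leaf(3) irrefl by auto
        note card = card_remove_two[OF less.prems(1) leaf(1,2) vu]
        have sub: "V - {v} \<subset> V" "?W \<subset> V"
          using leaf(1) by blast+
        have e: "e V = e (V - {v}) + 1"
          using card_edge_pairs_leaf[OF less.prems(1) leaf] by (simp add: e_def)
        have eq: "t ^ card V * (t\<^sup>2 + e V) =
              t * (t ^ card (V - {v}) * (t\<^sup>2 + e (V - {v}))) + t ^ card ?W * t\<^sup>2"
            "t\<^sup>2 * char_det t V = t * (t\<^sup>2 * char_det t (V - {v})) + t\<^sup>2 * char_det t ?W"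
          using char_det_leaf[OF less.prems(1) leaf, of t] card
          by (simp_all add: e algebra_simps power2_eq_square)
        have 1: "t * (t ^ card (V - {v}) * (t\<^sup>2 + e (V - {v}))) \<le> t * (t\<^sup>2 * char_det t (V - {v}))"
          using IH(1)[OF sub(1)] assms(1) by simp
        have 2: "t ^ card ?W * t\<^sup>2 \<le> t ^ card ?W * (t\<^sup>2 + e ?W)"
          using e_nonneg[of ?W] assms(1) by simp
        have "t ^ card ?W * t\<^sup>2 < t ^ card ?W * (t\<^sup>2 + e ?W)" if "\<not> star_on adj V"
        proof -
          have "\<not> (\<forall>x\<in>V. \<forall>y\<in>V. adj x y \<longrightarrow> x = u \<or> y = u)"
            using that unfolding star_on_def by blast
          then obtain x y where xy: "x \<in> V" "y \<in> V" "adj x y" "x \<noteq> u" "y \<noteq> u" by blast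
          then have "x \<noteq> v" "y \<noteq> v" using leaf(4) sym by blast+
          then have "(x, y) \<in> edge_pairs adj ?W" using xy by (simp add: edge_pairs_def)
          then have "e ?W > 0"
            using less.prems(1) by (auto simp: e_def card_gt_0_iff)
          then show ?thesis using assms(1) by simp
        qed
        then show ?thesis unfolding eq using 1 2 IH(1)[OF sub(2)] by force
      qed
    qed
  qed
  then show "t\<^sup>2 * char_det t V \<ge> t ^ card V * (t\<^sup>2 + card (edge_pairs adj V) / 2)"
    and "\<not> star_on adj V \<Longrightarrow> t\<^sup>2 * char_det t V > t ^ card V * (t\<^sup>2 + card (edge_pairs adj V) / 2)"
    by blast+
qed

lemma char_det_star:
  assumes "finite V" "star_on adj V"
  shows "t\<^sup>2 * char_det t V = t ^ card V * (t\<^sup>2 + card (edge_pairs adj V) / 2)"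
  using assms
proof (induction "card V" arbitrary: V rule: less_induct)
  case less
  show ?case
  proof (cases "\<exists>x\<in>V. \<exists>y\<in>V. adj x y")
    case False
    then have "edge_pairs adj V = {}" by (auto simp: edge_pairs_def)
    then show ?thesis using char_det_no_edges[OF less.prems(1), of t] False by simp
  next
    case True
    obtain c where c: "\<forall>x\<in>V. \<forall>y\<in>V. adj x y \<longrightarrow> x = c \<or> y = c"
      using less.prems(2) unfolding star_on_def by blast
    then obtain v where v: "v \<in> V" "c \<in> V" "adj v c"
      using True sym by metis
    have vc: "v \<noteq> c" using v(3) irrefl by auto
    have leaf: "\<forall>w\<in>V. adj v w \<longrightarrow> w = c" using c v vc by blast
    let ?W = "V - {v, c}"
    note card = card_remove_two[OF less.prems(1) v(1,2) vc]
    have "star_on adj (V - {v})" using c unfolding star_on_def by blast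
    then have IH: "t\<^sup>2 * char_det t (V - {v}) = t ^ card (V - {v}) * (t\<^sup>2 + card (edge_pairs adj (V - {v})) / 2)"
      using less.prems(1) card(1) by (intro less.hyps) auto
    have "char_det t ?W = t ^ card ?W"
      using less.prems(1) c by (intro char_det_no_edges) auto
    then have "t\<^sup>2 * char_det t V = t * (t\<^sup>2 * char_det t (V - {v})) + t\<^sup>2 * t ^ card ?W"
      using char_det_leaf[OF less.prems(1) v leaf, of t] by (simp add: algebra_simps)
    also have "\<dots> = t ^ card V * (t\<^sup>2 + card (edge_pairs adj V) / 2)"
      unfolding IH card_edge_pairs_leaf[OF less.prems(1) v leaf] card
      by (simp add: algebra_simps power2_eq_square add_divide_distrib)
    finally show ?thesis .
  qed
qed

lemma induced_path_Cons:
  assumes "induced_path adj (x # y # zs)"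
  shows "adj x y" "\<forall>w\<in>set (x # y # zs). adj x w \<longrightarrow> w = y" "induced_path adj (y # zs)" "induced_path adj zs"
proof -
  have E: "adj ((x # y # zs) ! i) ((x # y # zs) ! j) \<longleftrightarrow> j = Suc i \<or> i = Suc j"
    if "i < length (x # y # zs)" "j < length (x # y # zs)" for i j
    using assms that unfolding induced_path_def by blast
  show "adj x y" using E[of 0 1] by simp
  show "\<forall>w\<in>set (x # y # zs). adj x w \<longrightarrow> w = y"
  proof (intro ballI impI)
    fix w assume w: "w \<in> set (x # y # zs)" "adj x w"
    then obtain j where "j < length (x # y # zs)" "w = (x # y # zs) ! j"
      by (metis in_set_conv_nth)
    then show "w = y" using E[of 0 j] w(2) by simp
  qed
  have "induced_path adj ws" if "x # y # zs = us @ ws" for us ws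
    unfolding induced_path_def
  proof (intro conjI allI impI)
    show "distinct ws" using assms that by (simp add: induced_path_def)
    fix i j assume "i < length ws" "j < length ws"
    then show "adj (ws ! i) (ws ! j) \<longleftrightarrow> j = Suc i \<or> i = Suc j"
      using E[of "length us + i" "length us + j"] unfolding that by (simp add: nth_append)
  qed
  from this[of "[x]" "y # zs"] this[of "[x, y]" zs]
  show "induced_path adj (y # zs)" "induced_path adj zs" by simp_all
qed

lemma char_det_induced_path:
  "induced_path adj xs \<Longrightarrow> char_det t (set xs) = path_char_poly t (length xs)"
proof (induction xs rule: induct_list012)
  case (2 x)
  show ?case using char_det_no_edges[of "{x}" t] irrefl by simp
next
  case (3 x y zs)
  note path = induced_path_Cons[OF 3(3)]
  have "distinct (x # y # zs)" using 3(3) by (simp add: induced_path_def)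
  then have sets: "set (x # y # zs) - {x} = set (y # zs)" "set (x # y # zs) - {x, y} = set zs" by auto
  have "char_det t (set (x # y # zs)) = t * char_det t (set (y # zs)) + char_det t (set zs)"
    using char_det_leaf[of "set (x # y # zs)" x y t] path(1,2) unfolding sets by simp
  then show ?case using 3(1)[OF path(4)] 3(2)[OF path(3)] by simp
qed simp

lemma induced_path_rev:
  assumes "induced_path adj xs"
  shows "induced_path adj (rev xs)"
  unfolding induced_path_def
proof (intro conjI allI impI)
  show "distinct (rev xs)" using assms by (simp add: induced_path_def)
  fix i j assume ij: "i < length (rev xs)" "j < length (rev xs)"
  let ?i = "length xs - Suc i" and ?j = "length xs - Suc j"
  have "adj (xs ! ?i) (xs ! ?j) \<longleftrightarrow> ?j = Suc ?i \<or> ?i = Suc ?j"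
    using assms ij unfolding induced_path_def by simp
  also have "\<dots> \<longleftrightarrow> j = Suc i \<or> i = Suc j" using ij by auto
  finally show "adj (rev xs ! i) (rev xs ! j) \<longleftrightarrow> j = Suc i \<or> i = Suc j"
    using ij by (simp add: rev_nth)
qed

lemma induced_path_ConsI:
  assumes xs: "induced_path adj (u # us)"
    and v: "v \<notin> set (u # us)" "adj v u" "\<forall>w\<in>set (u # us). adj v w \<longrightarrow> w = u"
  shows "induced_path adj (v # u # us)"
  unfolding induced_path_def
proof (intro conjI allI impI)
  show "distinct (v # u # us)" using xs v(1) by (simp add: induced_path_def)
  have E: "adj v ((u # us) ! j) \<longleftrightarrow> j = 0" if "j < length (u # us)" for j
  proof
    assume "adj v ((u # us) ! j)"
    then have "(u # us) ! j = (u # us) ! 0"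
      using bspec[OF v(3) nth_mem[OF that]] by (simp del: nth_Cons_Suc)
    then show "j = 0"
      using xs that nth_eq_iff_index_eq[of "u # us" j 0] unfolding induced_path_def by simp
  qed (use v(2) in simp)
  have E': "adj ((u # us) ! j) v \<longleftrightarrow> j = 0" if "j < length (u # us)" for j
    using E[OF that] sym by blast
  fix i j assume "i < length (v # u # us)" "j < length (v # u # us)"
  moreover have "adj ((u # us) ! a) ((u # us) ! b) \<longleftrightarrow> b = Suc a \<or> a = Suc b"
    if "a < length (u # us)" "b < length (u # us)" for a b
    using xs that unfolding induced_path_def by blast
  ultimately show "adj ((v # u # us) ! i) ((v # u # us) ! j) \<longleftrightarrow> j = Suc i \<or> i = Suc j"
    using E E' irrefl by (cases i; cases j) (simp_all del: nth_Cons_Suc add: nth_Cons)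
qed

text \<open>
  The path \<open>ys\<close> shows that deleting \<open>u\<close> from the path \<open>xs\<close> does not disconnect it. So \<open>u\<close> is an end of
  \<open>xs\<close>, and \<open>v\<close> can be attached there.
\<close>

lemma induced_path_extend:
  assumes xs: "induced_path adj xs" and ys: "induced_path adj ys"
    and u: "u \<in> set xs" "set ys = set xs - {u}"
    and v: "v \<notin> set xs" "adj v u" "\<forall>w\<in>set xs. adj v w \<longrightarrow> w = u"
  shows "\<exists>zs. induced_path adj zs \<and> set zs = insert v (set xs)"
proof -
  obtain as bs where split: "xs = as @ u # bs"
    using u(1) by (meson split_list)
  have dist: "distinct xs" using xs by (simp add: induced_path_def)
  (* In the third case the two sides of u are separated by deleting u,
     although the path ys connects them. *)
  consider "as = []" | "bs = []" | "as \<noteq> []" "bs \<noteq> []" by blast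
  then show ?thesis
  proof cases
    case 1
    then have s: "xs = u # bs" using split by simp
    have "induced_path adj (v # xs)"
      unfolding s by (rule induced_path_ConsI) (use xs v in \<open>simp_all only: s not_False_eq_True\<close>)
    then show ?thesis by (intro exI[of _ "v # xs"]) simp
  next
    case 2
    then have r: "rev xs = u # rev as" using split by simp
    have s: "set (u # rev as) = set xs" using 2 split by auto
    have "induced_path adj (v # u # rev as)"
      by (rule induced_path_ConsI) (use induced_path_rev[OF xs] r v in \<open>simp_all only: s not_False_eq_True\<close>)
    moreover have "set (v # u # rev as) = insert v (set xs)" using s by simp
    ultimately show ?thesis by blast
  next
    case 3
    have ys_set: "set ys = set as \<union> set bs" using u(2) dist split by auto
    have "set as \<noteq> set ys" using 3(2) dist split ys_set by (cases bs) auto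
    then have "\<exists>x\<in>set as. \<exists>y\<in>set ys - set as. adj x y"
      using connected_on_induced_path[OF ys] 3(1) ys_set unfolding connected_on_def by simp
    then obtain x y where xy: "x \<in> set as" "y \<in> set bs" "adj x y" using ys_set by blast
    then obtain i j where i: "i < length as" "x = as ! i" and j: "j < length bs" "y = bs ! j"
      by (metis in_set_conv_nth)
    let ?j = "length as + Suc j"
    have "xs ! i = x" "xs ! ?j = y" "i < length xs" "?j < length xs"
      using i j split by (simp_all add: nth_append)
    then have "?j = Suc i \<or> i = Suc ?j"
      using xs xy(3) unfolding induced_path_def by blast
    then show ?thesis using i(1) by simp
  qed
qed

text \<open>
  Deleting a leaf \<open>v\<close> with neighbour \<open>u\<close> gives the same recursion that defines \<open>path_char_poly\<close>,
  with the forests on \<open>V - {v}\<close> and \<open>V - {v, u}\<close> in place of the shorter paths. Equality forces both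
  of them to be paths, and then \<open>v\<close> extends the longer one. If \<open>v\<close> is isolated, the
  second summand of the recursion is missing and the inequality is strict, unless \<open>V = {v}\<close>.
\<close>

lemma char_det_forest_le:
  assumes t: "t > 0" and "finite V" "forest_on adj V"
  shows "char_det t V \<le> path_char_poly t (card V)"
    and "char_det t V = path_char_poly t (card V) \<Longrightarrow> \<exists>xs. induced_path adj xs \<and> set xs = V"
proof -
  have "char_det t V \<le> path_char_poly t (card V) \<and>
    (char_det t V = path_char_poly t (card V) \<longrightarrow> (\<exists>xs. induced_path adj xs \<and> set xs = V))"
    using assms(2,3)
  proof (induction "card V" arbitrary: V rule: less_induct)
    case less
    have IH: "char_det t W \<le> path_char_poly t (card W)"
      "char_det t W = path_char_poly t (card W) \<Longrightarrow> \<exists>xs. induced_path adj xs \<and> set xs = W" if "W \<subset> V" for W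
      using less.hyps[of W] that less.prems psubset_card_mono[OF less.prems(1) that]
        forest_on_subset[OF less.prems(2), of W] finite_subset[OF _ less.prems(1), of W] by auto
    show ?case
    proof (cases "V = {}")
      case True
      then show ?thesis by (auto intro!: exI[of _ "[]"] simp: induced_path_def)
    next
      case False
      from less.prems(2) this
      show ?thesis
      proof (cases rule: forest_on_cases)
        case (isolated v)
        have V: "card V = Suc (card (V - {v}))" "V - {v} \<subset> V"
          using isolated(1) less.prems(1) card.remove by fastforce+
        have det: "char_det t V = t * char_det t (V - {v})"
          by (rule char_det_isolated[OF less.prems(1) isolated])
        show ?thesis
        proof (cases "card (V - {v})")
          case 0
          then have "V - {v} = {}" using less.prems(1) by simp
          then have "V = {v}" using isolated(1) by blast
          then show ?thesis
            using det irrefl by (auto intro!: exI[of _ "[v]"] simp: induced_path_def)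
        next
          case (Suc k)
          have "char_det t V \<le> t * path_char_poly t (card (V - {v}))"
            unfolding det using IH(1)[OF V(2)] t by simp
          also have "\<dots> < path_char_poly t (card V)"
            using path_char_poly_pos[OF t, of k] by (simp add: V(1) Suc)
          finally show ?thesis by simp
        qed
      next
        case (leaf v u)
        let ?W = "V - {v, u}"
        have vu: "v \<noteq> u" using leaf(3) irrefl by auto
        note card = card_remove_two[OF less.prems(1) leaf(1,2) vu]
        have sub: "V - {v} \<subset> V" "?W \<subset> V"
          using leaf(1) by blast+
        have det: "char_det t V = t * char_det t (V - {v}) + char_det t ?W"
          by (rule char_det_leaf[OF less.prems(1) leaf])
        have path: "path_char_poly t (card V) =
            t * path_char_poly t (card (V - {v})) + path_char_poly t (card ?W)"
          by (simp add: card)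
        have le: "t * char_det t (V - {v}) \<le> t * path_char_poly t (card (V - {v}))"
            "char_det t ?W \<le> path_char_poly t (card ?W)"
          using IH(1)[OF sub(1)] IH(1)[OF sub(2)] t by simp_all
        have "\<exists>xs. induced_path adj xs \<and> set xs = V" if "char_det t V = path_char_poly t (card V)"
        proof -
          have "t * char_det t (V - {v}) = t * path_char_poly t (card (V - {v}))"
            and W: "char_det t ?W = path_char_poly t (card ?W)"
            using that det path le by linarith+
          then have "char_det t (V - {v}) = path_char_poly t (card (V - {v}))" using t by simp
          then obtain xs ys where "induced_path adj xs" "set xs = V - {v}" "induced_path adj ys" "set ys = ?W"
            using IH(2)[OF sub(1)] IH(2)[OF sub(2) W] by blast
          moreover from this have "u \<in> set xs" "set ys = set xs - {u}" "v \<notin> set xs"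
              "\<forall>w\<in>set xs. adj v w \<longrightarrow> w = u"
            using leaf(2,4) vu by auto
          ultimately have "\<exists>zs. induced_path adj zs \<and> set zs = insert v (set xs)"
            using leaf(3) by (intro induced_path_extend[of xs ys u v])
          moreover have "insert v (set xs) = V"
            using \<open>set xs = V - {v}\<close> leaf(1) by blast
          ultimately show ?thesis by (simp only:)
        qed
        moreover have "char_det t V \<le> path_char_poly t (card V)"
          using det path le by linarith
        ultimately show ?thesis by blast
      qed
    qed
  qed
  then show "char_det t V \<le> path_char_poly t (card V)"
    and "char_det t V = path_char_poly t (card V) \<Longrightarrow> \<exists>xs. induced_path adj xs \<and> set xs = V"
    by blast+
qed

end

section \<open>Isomorphisms and trees among the underlying graphs\<close>

text \<open>
  An isomorphism of digraphs carries separate maps for vertices and arcs. When arcs are pairs, the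
  vertex map determines the arc map.
\<close>

lemma graph_isoE:
  fixes G :: "'a pair_pre_digraph" and H :: "'b pair_pre_digraph"
  assumes "G \<cong>\<^sub>G H"
  obtains f where "bij_betw f (pverts G) (pverts H)"
    "\<And>x y. x \<in> pverts G \<Longrightarrow> y \<in> pverts G \<Longrightarrow> (x, y) \<in> parcs G \<longleftrightarrow> (f x, f y) \<in> parcs H"
    "card (parcs G) = card (parcs H)"
proof -
  obtain h where h: "pre_digraph.digraph_isomorphism (with_proj G) h" and H: "with_proj H = app_iso h (with_proj G)"
    using assms unfolding digraph_iso_def by blast
  have "verts (with_proj H) = verts (app_iso h (with_proj G))" "arcs (with_proj H) = arcs (app_iso h (with_proj G))"
    "tail (with_proj H) = tail (app_iso h (with_proj G))" "head (with_proj H) = head (app_iso h (with_proj G))"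
    unfolding H by simp_all
  then have H: "pverts H = iso_verts h ` pverts G" "parcs H = iso_arcs h ` parcs G"
    "iso_tail h = fst" "iso_head h = snd"
    by simp_all
  have wf: "wf_digraph (with_proj G)"
    and inj: "inj_on (iso_verts h) (pverts G)" "inj_on (iso_arcs h) (parcs G)"
    and arc: "\<forall>a\<in>parcs G. iso_verts h (fst a) = fst (iso_arcs h a) \<and> iso_verts h (snd a) = snd (iso_arcs h a)"
    using h unfolding pre_digraph.digraph_isomorphism_def H(3,4) by simp_all
  have in_verts: "x \<in> pverts G" "y \<in> pverts G" if "(x, y) \<in> parcs G" for x y
    using wf_digraph.tail_in_verts[OF wf, of "(x, y)"] wf_digraph.head_in_verts[OF wf, of "(x, y)"] that by simp_all
  show thesis
  proof
    show "bij_betw (iso_verts h) (pverts G) (pverts H)"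
      using inj(1) H(1) by (simp add: bij_betw_def)
    show "card (parcs G) = card (parcs H)"
      using inj(2) H(2) by (simp add: card_image)
    fix x y assume xy: "x \<in> pverts G" "y \<in> pverts G"
    have arc_eq: "iso_arcs h (a, b) = (iso_verts h a, iso_verts h b)" if "(a, b) \<in> parcs G" for a b
      using bspec[OF arc that] by (simp add: prod_eq_iff)
    show "(x, y) \<in> parcs G \<longleftrightarrow> (iso_verts h x, iso_verts h y) \<in> parcs H"
    proof
      assume "(x, y) \<in> parcs G"
      then show "(iso_verts h x, iso_verts h y) \<in> parcs H"
        unfolding H(2) using arc_eq by (metis imageI)
    next
      assume "(iso_verts h x, iso_verts h y) \<in> parcs H"
      then obtain a b where ab: "(a, b) \<in> parcs G" "(iso_verts h x, iso_verts h y) = iso_arcs h (a, b)"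
        unfolding H(2) by auto
      then have "x = a" "y = b"
        using arc_eq[OF ab(1)] inj_onD[OF inj(1)] xy in_verts[OF ab(1)] by simp_all
      with ab(1) show "(x, y) \<in> parcs G" by simp
    qed
  qed
qed

lemma graph_isoI:
  fixes G :: "'a pair_pre_digraph" and H :: "'b pair_pre_digraph"
  assumes G: "parcs G \<subseteq> pverts G \<times> pverts G" and H: "parcs H \<subseteq> pverts H \<times> pverts H"
    and f: "bij_betw f (pverts G) (pverts H)"
    and arc: "\<And>x y. x \<in> pverts G \<Longrightarrow> y \<in> pverts G \<Longrightarrow> (x, y) \<in> parcs G \<longleftrightarrow> (f x, f y) \<in> parcs H"
  shows "G \<cong>\<^sub>G H"
proof -
  define h :: "('a, 'a \<times> 'a, 'b, 'b \<times> 'b) digraph_isomorphism" where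
    "h = \<lparr>iso_verts = f, iso_arcs = map_prod f f, iso_head = snd, iso_tail = fst\<rparr>"
  have inj: "inj_on f (pverts G)" and im: "f ` pverts G = pverts H"
    using f by (auto simp: bij_betw_def)
  have "wf_digraph (with_proj G)"
    using G by (auto simp: wf_digraph_def)
  moreover have "inj_on (map_prod f f) (parcs G)"
    using map_prod_inj_on[OF inj inj] G by (rule inj_on_subset)
  ultimately have "pre_digraph.digraph_isomorphism (with_proj G) h"
    using inj by (auto simp: pre_digraph.digraph_isomorphism_def h_def)
  moreover have "parcs H = map_prod f f ` parcs G"
  proof
    show "map_prod f f ` parcs G \<subseteq> parcs H"
      using G arc by auto
    show "parcs H \<subseteq> map_prod f f ` parcs G"
    proof
      fix p assume p: "p \<in> parcs H"
      obtain a b where ab: "p = (a, b)" by (cases p)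
      then have "a \<in> f ` pverts G" "b \<in> f ` pverts G" using H p im by auto
      then obtain x y where xy: "x \<in> pverts G" "y \<in> pverts G" "a = f x" "b = f y" by blast
      then have "(x, y) \<in> parcs G" using arc[OF xy(1,2)] p ab by simp
      then show "p \<in> map_prod f f ` parcs G" using ab xy by force
    qed
  qed
  then have "with_proj H = app_iso h (with_proj G)"
    using im by (simp add: with_proj_def app_iso_def h_def)
  ultimately show ?thesis unfolding digraph_iso_def by blast
qed

lemma card_parcs_star_graph: "card (parcs (star_graph n)) = 2 * (n - 1)"
proof -
  have "parcs (star_graph n) = {0} \<times> {1..<n} \<union> {1..<n} \<times> {0}"
    by (auto simp: star_graph_def)
  moreover have "card ({0} \<times> {1..<n} \<union> {1..<n} \<times> {0}) = card ({0::nat} \<times> {1..<n}) + card ({1..<n} \<times> {0::nat})"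
    by (intro card_Un_disjoint) auto
  ultimately show ?thesis by (simp add: card_cartesian_product)
qed

lemma card_parcs_path_graph: "card (parcs (path_graph n)) = 2 * (n - 1)"
proof -
  have "parcs (path_graph n) = (\<lambda>i. (i, Suc i)) ` {..<n - 1} \<union> (\<lambda>i. (Suc i, i)) ` {..<n - 1}"
    by (auto simp: path_graph_def)
  moreover have "card ((\<lambda>i. (i, Suc i)) ` {..<n - 1} \<union> (\<lambda>i. (Suc i, i)) ` {..<n - 1}) =
      card ((\<lambda>i. (i, Suc i)) ` {..<n - 1}) + card ((\<lambda>i. (Suc i, i)) ` {..<n - 1})"
    by (intro card_Un_disjoint) auto
  ultimately show ?thesis by (simp add: card_image inj_on_def)
qed

lemma walk_arcs_of_vertex_list:
  assumes "successively (\<lambda>a b. (a, b) \<in> R) ws" "ws \<noteq> []"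
  shows "set (zip ws (tl ws)) \<subseteq> R" "pcas (hd ws) (zip ws (tl ws)) (last ws)"
    "pawalk_verts (hd ws) (zip ws (tl ws)) = ws"
  using assms by (induction ws rule: induct_list012) auto

text \<open>
  Take a longest path inside \<open>W\<close>. By maximality all neighbours in \<open>W\<close> of its first vertex \<open>x\<close> lie on the
  path, and one of them differs from the second vertex; closing the path there gives a cycle of length
  at least three.
\<close>

lemma cycle_if_min_degree_2:
  fixes G :: "'a pair_pre_digraph"
  assumes G: "parcs G \<subseteq> pverts G \<times> pverts G" "finite (pverts G)"
    and sym: "\<And>x y. (x, y) \<in> parcs G \<Longrightarrow> (y, x) \<in> parcs G" and irrefl: "\<And>x. (x, x) \<notin> parcs G"
    and W: "W \<subseteq> pverts G" "W \<noteq> {}"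
    and deg: "\<forall>v\<in>W. \<exists>x\<in>W. \<exists>y\<in>W. (v, x) \<in> parcs G \<and> (v, y) \<in> parcs G \<and> x \<noteq> y"
  shows "\<exists>p. pre_digraph.cycle (with_proj G) p \<and> length p \<ge> 3"
proof -
  let ?adj = "\<lambda>a b. (a, b) \<in> parcs G"
  define path where "path xs \<longleftrightarrow> xs \<noteq> [] \<and> distinct xs \<and> set xs \<subseteq> W \<and> successively ?adj xs" for xs
  have finW: "finite W" using W(1) G(2) finite_subset by blast
  obtain w where "w \<in> W" using W(2) by blast
  then have "path [w]" by (simp add: path_def)
  moreover have "length xs < Suc (card W)" if "path xs" for xs
  proof -
    have "length xs = card (set xs)" using that by (simp add: path_def distinct_card)
    also have "\<dots> \<le> card W" using that finW by (intro card_mono) (auto simp: path_def)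
    finally show ?thesis by simp
  qed
  ultimately obtain xs where xs: "path xs" "\<And>ys. path ys \<Longrightarrow> length ys \<le> length xs"
    using ex_has_greatest_nat[of path "[w]" length "Suc (card W)"] by (auto simp: less_imp_le)
  obtain x ys where xys: "xs = x # ys" using xs(1) by (cases xs) (auto simp: path_def)
  have nbr: "y \<in> set ys" if "y \<in> W" "?adj x y" for y
  proof (rule ccontr)
    assume "y \<notin> set ys"
    moreover have "y \<noteq> x" using that(2) irrefl by blast
    ultimately have "path (y # xs)"
      using xs(1) that sym[OF that(2)] by (simp add: path_def xys)
    then show False using xs(2)[of "y # xs"] by simp
  qed
  have "x \<in> W" using xs(1) by (simp add: path_def xys)
  then obtain a b where ab: "a \<in> W" "b \<in> W" "?adj x a" "?adj x b" "a \<noteq> b"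
    using deg by blast
  then have "a \<in> set ys" "b \<in> set ys" using nbr by blast+
  then obtain z zs where ys: "ys = z # zs" by (cases ys) auto
  then obtain y where y: "y \<in> set zs" "?adj x y"
    using \<open>a \<in> set ys\<close> \<open>b \<in> set ys\<close> ab by auto
  then obtain ps qs where zs: "zs = ps @ y # qs" by (meson split_list)
  define ws where "ws = x # z # ps @ [y, x]"
  have split: "xs = (x # z # ps @ [y]) @ qs" by (simp add: xys ys zs)
  have "successively ?adj (x # z # ps @ [y])"
    using xs(1) unfolding path_def split successively_append_iff by blast
  moreover have "?adj y x" using y(2) sym by blast
  ultimately have "successively ?adj ((x # z # ps @ [y]) @ [x])"
    unfolding successively_append_iff by simp
  then have suc: "successively ?adj ws" by (simp add: ws_def)
  have "distinct xs" using xs(1) by (simp add: path_def)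
  then have dist: "distinct (tl ws)" by (auto simp: split ws_def)
  have hd: "hd ws = x" "last ws = x" "ws \<noteq> []" by (auto simp: ws_def)
  note walk = walk_arcs_of_vertex_list[OF suc hd(3), unfolded hd]
  have "x \<in> pverts G" using \<open>x \<in> W\<close> W(1) by blast
  then have "pre_digraph.awalk (with_proj G) x (zip ws (tl ws)) x"
    using walk by (simp add: pre_digraph.awalk_def cas_with_proj_eq)
  moreover have "distinct (tl (pre_digraph.awalk_verts (with_proj G) x (zip ws (tl ws))))"
    using walk(3) dist by (simp add: awalk_verts_with_proj_eq)
  moreover have "length (zip ws (tl ws)) \<ge> 3" by (simp add: ws_def)
  moreover from this have "zip ws (tl ws) \<noteq> []" by (metis list.size(3) not_numeral_le_zero)
  ultimately show ?thesis
    unfolding pre_digraph.cycle_def by blast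
qed

lemma connected_on_if_connected:
  fixes G :: "'a pair_pre_digraph"
  assumes "Digraph_Component.connected (with_proj G)"
    and G: "parcs G \<subseteq> pverts G \<times> pverts G" and sym: "\<And>x y. (x, y) \<in> parcs G \<Longrightarrow> (y, x) \<in> parcs G"
  shows "connected_on (\<lambda>x y. (x, y) \<in> parcs G) (pverts G)"
  unfolding connected_on_def
proof (intro allI impI)
  fix A assume A: "A \<subseteq> pverts G" "A \<noteq> {}" "A \<noteq> pverts G"
  obtain x y where xy: "x \<in> A" "y \<in> pverts G - A" using A by blast
  then have "x \<rightarrow>\<^sup>*\<^bsub>with_proj (mk_symmetric (with_proj G))\<^esub> y"
    using assms(1) A(1) unfolding Digraph_Component.connected_def strongly_connected_def by auto
  then have "(x, y) \<in> (arcs_ends (with_proj (mk_symmetric (with_proj G))))\<^sup>*"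
    by (rule reachable_rtranclI)
  moreover have "parcs (mk_symmetric (with_proj G)) = parcs G"
    using sym by (auto simp: parcs_mk_symmetric)
  ultimately have path: "(x, y) \<in> (parcs G)\<^sup>*" by simp
  show "\<exists>x\<in>A. \<exists>y\<in>pverts G - A. (x, y) \<in> parcs G"
  proof (rule ccontr)
    assume neg: "\<not> ?thesis"
    from path have "y \<in> A"
    proof (induction rule: rtrancl_induct)
      case base
      then show ?case using xy(1) .
    next
      case (step y z)
      then show ?case using neg G by blast
    qed
    then show False using xy(2) by blast
  qed
qed

section \<open>The skew spectrum of an oriented graph\<close>

definition skew_entry :: "'a pair_pre_digraph \<Rightarrow> 'a \<Rightarrow> 'a \<Rightarrow> real" where
  "skew_entry D x y = (if (x, y) \<in> parcs D then 1 else if (y, x) \<in> parcs D then - 1 else 0)"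

lemma parcs_underlying: "(x, y) \<in> parcs (underlying D) \<longleftrightarrow> (x, y) \<in> parcs D \<or> (y, x) \<in> parcs D"
  by (auto simp: parcs_mk_symmetric intro: bexI[of _ "(y, x)"])

lemma sum_mset_cmod_nonneg: "(\<Sum>l\<in>#M. cmod l) \<ge> 0"
  by (induction M) auto

locale numbered_oriented_graph = oriented_graph D for D :: "'a pair_pre_digraph" +
  fixes vs :: "'a list"
  assumes numbering: "vertex_numbering vs D"
begin

lemma distinct_vs: "distinct vs" and set_vs: "set vs = pverts D"
  using numbering by (auto simp: vertex_numbering_def)

lemma length_vs: "length vs = card (pverts D)"
  using distinct_card[OF distinct_vs] set_vs by simp

lemma finite_verts_D: "finite (pverts D)"
  using set_vs by (metis List.finite_set)

sublocale weights: skew_weights "skew_entry D"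
proof
  show "skew_entry D x y = - skew_entry D y x" for x y
    using one_direction[of x y] by (simp add: skew_entry_def)
  show "skew_entry D x y \<in> {- 1, 0, 1}" for x y
    by (simp add: skew_entry_def)
qed

lemma adj_iff: "weights.adj x y \<longleftrightarrow> (x, y) \<in> parcs (underlying D)"
  unfolding weights.adj_def parcs_underlying by (simp add: skew_entry_def)

lemma adj_eq: "weights.adj = (\<lambda>x y. (x, y) \<in> parcs (underlying D))"
  by (intro ext) (rule adj_iff)

lemma parcs_underlying_subset: "parcs (underlying D) \<subseteq> pverts D \<times> pverts D"
  using in_arcsD1 in_arcsD2 by (auto simp: parcs_underlying)

lemma edge_pairs_eq: "edge_pairs weights.adj (pverts D) = parcs (underlying D)"
  using parcs_underlying_subset by (auto simp: edge_pairs_def adj_iff)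

lemma card_parcs_underlying: "card (parcs (underlying D)) = 2 * card (parcs D)"
proof -
  have "parcs (underlying D) = parcs D \<union> (parcs D)\<inverse>"
    by (intro equalityI subrelI) (auto simp: parcs_underlying)
  moreover have "parcs D \<inter> (parcs D)\<inverse> = {}"
    using one_direction by auto
  ultimately show ?thesis
    using pair_finite_arcs by (simp add: card_Un_disjoint card_inverse)
qed

lemma skew_adj_mat_entry:
  assumes "i < length vs" "j < length vs"
  shows "skew_adj_mat vs D $$ (i, j) = of_real (skew_entry D (vs ! i) (vs ! j))"
  using assms by (simp add: skew_adj_mat_def skew_entry_def)

sublocale spectrum: real_skew_matrix "skew_adj_mat vs D" "length vs"
proof
  show "skew_adj_mat vs D \<in> carrier_mat (length vs) (length vs)"
    by (simp add: skew_adj_mat_def)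
  fix i j assume ij: "i < length vs" "j < length vs"
  show "skew_adj_mat vs D $$ (j, i) = - skew_adj_mat vs D $$ (i, j)"
    unfolding skew_adj_mat_entry[OF ij] skew_adj_mat_entry[OF ij(2,1)]
    by (metis of_real_minus weights.skew)
  show "skew_adj_mat vs D $$ (i, j) \<in> \<real>"
    by (simp add: skew_adj_mat_entry[OF ij])
qed

lemma bij_betw_vs: "bij_betw ((!) vs) {0..<length vs} (pverts D)"
  using bij_betw_nth[OF distinct_vs, of "{0..<length vs}" "pverts D"] set_vs by (simp add: atLeast0LessThan)

text \<open>
  The numbering of the vertices only permutes rows and columns simultaneously, so the determinant
  depends on the vertex set alone.
\<close>

lemma char_poly_eq_char_det:
  "poly (char_poly (skew_adj_mat vs D)) (of_real t) = of_real (weights.char_det t (pverts D))"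
proof -
  let ?A = "skew_adj_mat vs D" and ?n = "length vs"
  let ?M = "\<lambda>x y. if x = y then t else - skew_entry D x y"
  have car: "- char_matrix ?A (of_real t) \<in> carrier_mat ?n ?n"
    using spectrum.carrier by (auto simp: char_matrix_def)
  have "poly (char_poly ?A) (of_real t) = det (- char_matrix ?A (of_real t))"
    by (rule char_poly_matrix[OF spectrum.carrier])
  also have "\<dots> = set_det (\<lambda>i j. (- char_matrix ?A (of_real t)) $$ (i, j)) {0..<?n}"
    by (rule det_eq_set_det[OF car])
  also have "\<dots> = set_det (\<lambda>i j. of_real (?M (vs ! i) (vs ! j))) {0..<?n}"
    unfolding set_det_def
  proof (intro sum.cong refl)
    fix p assume "p \<in> {p. p permutes {0..<?n}}"
    then have p: "p i < ?n" if "i < ?n" for i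
      using that permutes_in_image[of p "{0..<?n}" i] by simp
    have loopfree: "(x, x) \<notin> parcs D" for x
      using one_direction by blast
    have "(- char_matrix ?A (of_real t)) $$ (i, j) = of_real (?M (vs ! i) (vs ! j))"
      if "i < ?n" "j < ?n" for i j
      using that spectrum.carrier skew_adj_mat_entry[OF that] distinct_vs
      by (simp add: char_matrix_def nth_eq_iff_index_eq skew_entry_def loopfree)
    then have "(\<Prod>i\<in>{0..<?n}. (- char_matrix ?A (of_real t)) $$ (i, p i)) =
        (\<Prod>i\<in>{0..<?n}. (of_real (?M (vs ! i) (vs ! p i)) :: complex))"
      using p by (intro prod.cong) auto
    then show "of_int (sign p) * (\<Prod>i\<in>{0..<?n}. (- char_matrix ?A (of_real t)) $$ (i, p i)) =
        of_int (sign p) * (\<Prod>i\<in>{0..<?n}. (of_real (?M (vs ! i) (vs ! p i)) :: complex))"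
      by (simp only:)
  qed
  also have "\<dots> = set_det (\<lambda>x y. of_real (?M x y)) (pverts D)"
    by (rule set_det_reindex[OF bij_betw_vs, symmetric]) simp
  also have "\<dots> = of_real (weights.char_det t (pverts D))"
    unfolding weights.char_det_def set_det_of_real ..
  finally show ?thesis .
qed

text \<open>
  The skew energy of the graph.
\<close>

definition energy :: real where
  "energy = (\<Sum>l\<in>#skew_eigenvalues vs D. cmod l)"

lemma sum_cmod_square: "(\<Sum>l\<in>#skew_eigenvalues vs D. (cmod l)\<^sup>2) = 2 * real (card (parcs D))"
proof -
  let ?n = "length vs"
  let ?g = "\<lambda>x y. if weights.adj x y then 1 else 0 :: real"
  have "(\<Sum>l\<in>#skew_eigenvalues vs D. (cmod l)\<^sup>2) = (\<Sum>i<?n. \<Sum>j<?n. (cmod (skew_adj_mat vs D $$ (i, j)))\<^sup>2)"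
    unfolding skew_eigenvalues_def by (rule spectrum.sum_cmod_eigenvalues_square)
  also have "\<dots> = (\<Sum>i<?n. \<Sum>j<?n. ?g (vs ! i) (vs ! j))"
  proof (intro sum.cong refl)
    fix i j assume "i \<in> {..<?n}" "j \<in> {..<?n}"
    then show "(cmod (skew_adj_mat vs D $$ (i, j)))\<^sup>2 = ?g (vs ! i) (vs ! j)"
      by (simp add: skew_adj_mat_entry weights.adj_def skew_entry_def)
  qed
  also have "\<dots> = (\<Sum>i<?n. \<Sum>y\<in>pverts D. ?g (vs ! i) y)"
    unfolding lessThan_atLeast0 using sum.reindex_bij_betw[OF bij_betw_vs] by (intro sum.cong refl)
  also have "\<dots> = (\<Sum>x\<in>pverts D. \<Sum>y\<in>pverts D. ?g x y)"
    using sum.reindex_bij_betw[OF bij_betw_vs, of "\<lambda>x. \<Sum>y\<in>pverts D. ?g x y"] by (simp add: lessThan_atLeast0)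
  also have "\<dots> = (\<Sum>p\<in>pverts D \<times> pverts D. ?g (fst p) (snd p))"
    by (simp add: sum.cartesian_product case_prod_unfold)
  also have "\<dots> = (\<Sum>p\<in>edge_pairs weights.adj (pverts D). 1)"
    using finite_verts_D by (intro sum.mono_neutral_cong_right) (auto simp: edge_pairs_def)
  also have "\<dots> = 2 * real (card (parcs D))"
    by (simp add: edge_pairs_eq card_parcs_underlying)
  finally show ?thesis .
qed

lemma energy_pos:
  assumes "card (parcs D) \<ge> 1"
  shows "energy > 0"
proof (rule ccontr)
  assume "\<not> energy > 0"
  moreover have "(\<Sum>l\<in>#M. (cmod l)\<^sup>2) = 0" if "(\<Sum>l\<in>#M. cmod l) \<le> 0" for M :: "complex multiset"
    using that
  proof (induction M)
    case (add l M)
    have "(\<Sum>l\<in>#M. cmod l) \<ge> 0" by (rule sum_mset_cmod_nonneg)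
    then have "cmod l = 0" "(\<Sum>l\<in>#M. cmod l) \<le> 0"
      using add.prems norm_ge_zero[of l] by (simp_all del: norm_eq_zero norm_ge_zero)
    then show ?case using add.IH by simp
  qed simp
  ultimately show False
    using sum_cmod_square assms unfolding energy_def by simp
qed

text \<open>
  Since \<open>\<Sum>p\<^sub>i (1 - p\<^sub>i) = 1 - \<Sum>p\<^sub>i\<^sup>2\<close>, the number of arcs and the energy determine the entropy. For a fixed number of
  arcs it is strictly increasing in the energy.
\<close>

lemma I_S1_eq:
  assumes "card (parcs D) \<ge> 1"
  shows "I_S1 vs D = 1 - 2 * real (card (parcs D)) / energy\<^sup>2"
proof -
  have E: "energy > 0" by (rule energy_pos[OF assms])
  have "(\<Sum>l\<in>#M. cmod l / e * (1 - cmod l / e)) = (\<Sum>l\<in>#M. cmod l) / e - (\<Sum>l\<in>#M. (cmod l)\<^sup>2) / e\<^sup>2"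
    for M :: "complex multiset" and e
    by (induction M) (simp_all add: add_divide_distrib right_diff_distrib power2_eq_square)
  then have "I_S1 vs D = energy / energy - (\<Sum>l\<in>#skew_eigenvalues vs D. (cmod l)\<^sup>2) / energy\<^sup>2"
    by (simp add: I_S1_def skew_weight_def flip: energy_def)
  then show ?thesis using E by (simp add: sum_cmod_square)
qed

lemma char_det_square:
  assumes "t > 0"
  shows "(weights.char_det t (pverts D))\<^sup>2 = (\<Prod>a\<in>#image_mset cmod (skew_eigenvalues vs D). t\<^sup>2 + a\<^sup>2)"
  using spectrum.cmod_char_poly_square[of t] unfolding char_poly_eq_char_det skew_eigenvalues_def by simp

end

section \<open>Bounds for general oriented graphs\<close>

text \<open>
  McClelland's argument: the mixed products \<open>f i * f j\<close> have geometric mean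
  \<open>(\<Prod>i\<in>I. f i) powr (2 / n)\<close>. With \<open>f i = exp (y i)\<close> and \<open>c\<close> the arithmetic mean of the sums
  \<open>y i + y j\<close>, the arithmetic-geometric mean inequality comes from adding up the tangent bounds
  \<open>exp (y i + y j) \<ge> exp c * (1 + (y i + y j - c))\<close>, whose linear parts cancel.
\<close>

lemma sum_square_ge_geometric_mean:
  fixes f :: "'i \<Rightarrow> real"
  assumes I: "finite I" "card I = n" "n \<ge> 1" and f: "\<And>i. i \<in> I \<Longrightarrow> f i \<ge> 0"
  shows "(\<Sum>i\<in>I. f i)\<^sup>2 \<ge> (\<Sum>i\<in>I. (f i)\<^sup>2) + real n * (real n - 1) * (\<Prod>i\<in>I. f i) powr (2 / real n)"
proof -
  have split: "(\<Sum>i\<in>I. f i)\<^sup>2 = (\<Sum>i\<in>I. (f i)\<^sup>2) + (\<Sum>i\<in>I. \<Sum>j\<in>I - {i}. f i * f j)"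
  proof -
    have "(\<Sum>i\<in>I. f i)\<^sup>2 = (\<Sum>i\<in>I. \<Sum>j\<in>I. f i * f j)"
      by (simp add: power2_eq_square sum_product)
    also have "\<dots> = (\<Sum>i\<in>I. (f i)\<^sup>2 + (\<Sum>j\<in>I - {i}. f i * f j))"
      by (intro sum.cong refl) (simp add: sum.remove[OF I(1)] power2_eq_square)
    finally show ?thesis by (simp add: sum.distrib)
  qed
  have "real n * (real n - 1) * (\<Prod>i\<in>I. f i) powr (2 / real n) \<le> (\<Sum>i\<in>I. \<Sum>j\<in>I - {i}. f i * f j)"
  proof (cases "\<exists>i\<in>I. f i = 0")
    case True
    then have "(\<Prod>i\<in>I. f i) = 0" using I(1) by (intro prod_zero)
    moreover have "0 \<le> (\<Sum>i\<in>I. \<Sum>j\<in>I - {i}. f i * f j)"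
      using f by (intro sum_nonneg mult_nonneg_nonneg) auto
    ultimately show ?thesis by simp
  next
    case False
    then have pos: "f i > 0" if "i \<in> I" for i using f that by (metis order_le_less)
    define y where "y i = ln (f i)" for i
    define Y where "Y = (\<Sum>i\<in>I. y i)"
    define c where "c = 2 * Y / n"
    have prod: "(\<Prod>i\<in>I. f i) powr (2 / real n) = exp c"
    proof -
      have "(\<Prod>i\<in>I. f i) > 0" using pos by (intro prod_pos) auto
      moreover have "f i \<noteq> 0" if "i \<in> I" for i using pos[OF that] by simp
      then have "ln (\<Prod>i\<in>I. f i) = Y"
        unfolding Y_def y_def using I(1) by (intro ln_prod) auto
      ultimately show ?thesis by (simp add: powr_def c_def)
    qed
    have card: "real (card (I - {i})) = real n - 1" if "i \<in> I" for i
      using I that by (simp add: of_nat_diff)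
    have inner: "(\<Sum>j\<in>I - {i}. y i + y j - c) = (real n - 1) * (y i - c) + (Y - y i)" if "i \<in> I" for i
    proof -
      have "(\<Sum>j\<in>I - {i}. y j) = Y - y i"
        unfolding Y_def using sum.remove[OF I(1) that, of y] by simp
      moreover have "(\<Sum>j\<in>I - {i}. y i + y j - c) = real (card (I - {i})) * (y i - c) + (\<Sum>j\<in>I - {i}. y j)"
        by (simp add: sum.distrib sum_subtractf algebra_simps)
      ultimately show ?thesis by (simp only: card[OF that])
    qed
    have "(\<Sum>i\<in>I. \<Sum>j\<in>I - {i}. y i + y j - c) = (\<Sum>i\<in>I. (real n - 1) * (y i - c) + (Y - y i))"
      by (intro sum.cong refl inner)
    also have "\<dots> = (real n - 1) * (Y - real n * c) + (real n * Y - Y)"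
      using I(2) by (simp add: sum.distrib sum_subtractf Y_def flip: sum_distrib_left)
    also have "\<dots> = 0"
      using I(3) by (simp add: c_def algebra_simps)
    finally have zero: "(\<Sum>i\<in>I. \<Sum>j\<in>I - {i}. y i + y j - c) = 0" .
    have "(\<Sum>i\<in>I. \<Sum>j\<in>I - {i}. exp c * (1 + (y i + y j - c))) \<le> (\<Sum>i\<in>I. \<Sum>j\<in>I - {i}. f i * f j)"
    proof (intro sum_mono)
      fix i j assume "i \<in> I" "j \<in> I - {i}"
      then have "f i * f j = exp (y i + y j)"
        using pos by (simp add: y_def exp_add)
      also have "\<dots> = exp c * exp (y i + y j - c)"
        by (simp flip: exp_add)
      finally show "exp c * (1 + (y i + y j - c)) \<le> f i * f j"
        using exp_ge_add_one_self[of "y i + y j - c"] by simp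
    qed
    moreover have "(\<Sum>i\<in>I. \<Sum>j\<in>I - {i}. exp c * (1 + (y i + y j - c))) = real n * (real n - 1) * exp c"
    proof -
      have "(\<Sum>i\<in>I. \<Sum>j\<in>I - {i}. exp c * (1 + (y i + y j - c))) =
          exp c * ((\<Sum>i\<in>I. \<Sum>j\<in>I - {i}. 1) + (\<Sum>i\<in>I. \<Sum>j\<in>I - {i}. y i + y j - c))"
        by (simp only: sum_distrib_left[symmetric] sum.distrib[symmetric])
      also have "(\<Sum>i\<in>I. \<Sum>j\<in>I - {i}. (1::real)) = (\<Sum>i\<in>I. real n - 1)"
        by (intro sum.cong refl) (simp only: sum_constant card mult_1_right)
      also have "\<dots> = real n * (real n - 1)" using I(2) by simp
      finally show ?thesis by (simp only: zero add_0_right mult.commute)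
    qed
    ultimately show ?thesis unfolding prod by simp
  qed
  then show ?thesis unfolding split by simp
qed

lemma sum_square_le_card:
  fixes f :: "'i \<Rightarrow> real"
  assumes "finite I"
  shows "(\<Sum>i\<in>I. f i)\<^sup>2 \<le> real (card I) * (\<Sum>i\<in>I. (f i)\<^sup>2)"
proof -
  let ?Q = "\<Sum>i\<in>I. (f i)\<^sup>2"
  have "0 \<le> (\<Sum>i\<in>I. \<Sum>j\<in>I. (f i - f j)\<^sup>2)" by (intro sum_nonneg) auto
  also have "\<dots> = (\<Sum>i\<in>I. \<Sum>j\<in>I. (f i)\<^sup>2) + (\<Sum>i\<in>I. \<Sum>j\<in>I. (f j)\<^sup>2) - 2 * (\<Sum>i\<in>I. \<Sum>j\<in>I. f i * f j)"
    unfolding sum_distrib_left sum.distrib[symmetric] sum_subtractf[symmetric]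
    by (simp add: power2_diff mult.assoc)
  also have "(\<Sum>i\<in>I. \<Sum>j\<in>I. f i * f j) = (\<Sum>i\<in>I. f i)\<^sup>2"
    by (simp add: power2_eq_square sum_product)
  also have "(\<Sum>i\<in>I. \<Sum>j\<in>I. (f i)\<^sup>2) = real (card I) * ?Q"
    by (simp add: sum_distrib_left)
  also have "(\<Sum>i\<in>I. \<Sum>j\<in>I. (f j)\<^sup>2) = real (card I) * ?Q"
    by simp
  finally show ?thesis by simp
qed

context numbered_oriented_graph
begin

lemma energy_square_bounds:
  assumes "card (pverts D) \<ge> 1"
  defines "n \<equiv> card (pverts D)"
  shows "energy\<^sup>2 \<ge> 2 * real (card (parcs D)) + real n * (real n - 1) * cmod (det (skew_adj_mat vs D)) powr (2 / real n)"
    and "energy\<^sup>2 \<le> real n * (2 * real (card (parcs D)))"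
proof -
  obtain ls where ls: "mset ls = skew_eigenvalues vs D" using ex_mset by blast
  have len: "length ls = n"
    using spectrum.size_eigenvalues ls length_vs unfolding n_def skew_eigenvalues_def
    by (metis size_mset)
  have S: "(\<Sum>l\<in>#skew_eigenvalues vs D. g l) = (\<Sum>i\<in>{0..<n}. g (ls ! i))" for g :: "complex \<Rightarrow> real"
    by (simp add: ls[symmetric] sum_list_sum_nth len sum_mset_sum_list flip: mset_map)
  have E: "energy = (\<Sum>i\<in>{0..<n}. cmod (ls ! i))"
    unfolding energy_def by (rule S)
  have M: "2 * real (card (parcs D)) = (\<Sum>i\<in>{0..<n}. (cmod (ls ! i))\<^sup>2)"
    using sum_cmod_square unfolding S by simp
  have "cmod (det (skew_adj_mat vs D)) = (\<Prod>l\<in>#mset ls. cmod l)"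
    unfolding ls skew_eigenvalues_def by (rule spectrum.prod_cmod_eigenvalues[symmetric])
  also have "\<dots> = (\<Prod>l\<leftarrow>ls. cmod l)"
    by (simp flip: mset_map prod_mset_prod_list)
  also have "\<dots> = (\<Prod>i\<in>{0..<n}. cmod (ls ! i))"
    using prod.list_conv_set_nth[of "map cmod ls"] len by simp
  finally have P: "cmod (det (skew_adj_mat vs D)) = (\<Prod>i\<in>{0..<n}. cmod (ls ! i))" .
  show "energy\<^sup>2 \<ge> 2 * real (card (parcs D)) + real n * (real n - 1) * cmod (det (skew_adj_mat vs D)) powr (2 / real n)"
    unfolding E M P by (intro sum_square_ge_geometric_mean) (use assms in auto)
  show "energy\<^sup>2 \<le> real n * (2 * real (card (parcs D)))"
    using sum_square_le_card[of "{0..<n}" "\<lambda>i. cmod (ls ! i)"] unfolding E M by simp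
qed

lemma handshake_max_degree:
  "2 * card (parcs D) \<le> card (pverts D) * max_degree (underlying D)"
proof -
  let ?U = "underlying D"
  have "parcs ?U = (\<Union>v\<in>pverts D. out_arcs (with_proj ?U) v)"
    using parcs_underlying_subset by (fastforce simp: out_arcs_def)
  then have "card (parcs ?U) \<le> (\<Sum>v\<in>pverts D. card (out_arcs (with_proj ?U) v))"
    using card_UN_le[OF finite_verts_D] by simp
  also have "\<dots> \<le> (\<Sum>v\<in>pverts D. max_degree ?U)"
  proof (rule sum_mono)
    fix v assume "v \<in> pverts D"
    then show "card (out_arcs (with_proj ?U) v) \<le> max_degree ?U"
      unfolding max_degree_def out_degree_def[symmetric]
      using finite_verts_D by (intro Max_ge) auto
  qed
  finally show ?thesis by (simp add: card_parcs_underlying)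
qed

theorem I_S1_bounds:
  assumes m: "card (parcs D) \<ge> 1"
  defines "n \<equiv> card (pverts D)" and "m \<equiv> card (parcs D)" and "\<Delta> \<equiv> max_degree (underlying D)"
  shows "1 - 2 * real m /
      (2 * real m + real n * (real n - 1) * cmod (det (skew_adj_mat vs D)) powr (2 / real n)) \<le> I_S1 vs D"
    and "I_S1 vs D \<le> 1 - 1 / real n"
    and "1 - 1 / real n \<le> 1 - 2 * real m / (real n ^ 2 * real \<Delta>)"
proof -
  have deg: "2 * m \<le> n * \<Delta>" unfolding m_def n_def \<Delta>_def by (rule handshake_max_degree)
  then have pos: "n \<ge> 1" "\<Delta> \<ge> 1" using m unfolding m_def[symmetric] by (cases n; cases \<Delta>; simp)+
  have m1: "m \<ge> 1" using m by (simp add: m_def)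
  have E: "energy > 0" by (rule energy_pos[OF m])
  note bounds = energy_square_bounds[folded n_def m_def, OF pos(1)]
  have I: "I_S1 vs D = 1 - 2 * real m / energy\<^sup>2"
    unfolding m_def by (rule I_S1_eq[OF m])
  have den: "0 < 2 * real m + real n * (real n - 1) * cmod (det (skew_adj_mat vs D)) powr (2 / real n)"
    using m1 pos(1) by (intro add_pos_nonneg) auto
  show "1 - 2 * real m /
      (2 * real m + real n * (real n - 1) * cmod (det (skew_adj_mat vs D)) powr (2 / real n)) \<le> I_S1 vs D"
    unfolding I using bounds(1) den m1 E
    by (intro diff_left_mono divide_left_mono mult_pos_pos) auto
  have "1 / real n \<le> 2 * real m / energy\<^sup>2"
    using bounds(2) E pos(1) by (simp add: field_simps)
  then show "I_S1 vs D \<le> 1 - 1 / real n" unfolding I by simp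
  have "2 * real m \<le> real n * real \<Delta>"
    using deg by (metis of_nat_le_iff of_nat_mult of_nat_numeral)
  then have "2 * real m / (real n ^ 2 * real \<Delta>) \<le> 1 / real n"
    using pos by (simp add: field_simps power2_eq_square)
  then show "1 - 1 / real n \<le> 1 - 2 * real m / (real n ^ 2 * real \<Delta>)" by simp
qed

end

section \<open>Stars and paths are extremal among oriented trees\<close>

text \<open>
  Values of characteristic polynomials on the positive half-line control the energy, because the
  square of the characteristic polynomial is the product of the factors \<open>t\<^sup>2 + a\<^sup>2\<close> over the
  moduli \<open>a\<close> of the eigenvalues. Nonnegativity on the smaller side is what allows squaring.
\<close>

lemma I_S1_mono_char_det:
  assumes D: "numbered_oriented_graph D vs" and D': "numbered_oriented_graph D' vs'"
    and card: "card (pverts D) = card (pverts D')" "card (parcs D) = card (parcs D')" "card (parcs D) \<ge> 1"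
    and nonneg: "\<And>t. t > 0 \<Longrightarrow> 0 \<le> skew_weights.char_det (skew_entry D) t (pverts D)"
    and le: "\<And>t. t > 0 \<Longrightarrow> skew_weights.char_det (skew_entry D) t (pverts D)
                       \<le> skew_weights.char_det (skew_entry D') t (pverts D')"
  shows "I_S1 vs D \<le> I_S1 vs' D'"
    and "(\<And>t. t > 0 \<Longrightarrow> skew_weights.char_det (skew_entry D) t (pverts D)
                       < skew_weights.char_det (skew_entry D') t (pverts D')) \<Longrightarrow> I_S1 vs D < I_S1 vs' D'"
proof -
  interpret A: numbered_oriented_graph D vs by (rule D)
  interpret B: numbered_oriented_graph D' vs' by (rule D')
  let ?A = "image_mset cmod (skew_eigenvalues vs D)" and ?B = "image_mset cmod (skew_eigenvalues vs' D')"
  have size: "size ?A = size ?B"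
    using A.spectrum.size_eigenvalues B.spectrum.size_eigenvalues A.length_vs B.length_vs card(1)
    by (simp add: skew_eigenvalues_def)
  have nn: "\<forall>a\<in>#?A. a \<ge> 0" "\<forall>b\<in>#?B. b \<ge> 0" by auto
  have prod: "(\<Prod>a\<in>#?A. t\<^sup>2 + a\<^sup>2) \<le> (\<Prod>b\<in>#?B. t\<^sup>2 + b\<^sup>2)" if "t > 0" for t
    unfolding A.char_det_square[OF that, symmetric] B.char_det_square[OF that, symmetric]
    using le[OF that] nonneg[OF that] by (rule power_mono)
  have I: "I_S1 vs D = 1 - 2 * real (card (parcs D')) / A.energy\<^sup>2"
      "I_S1 vs' D' = 1 - 2 * real (card (parcs D')) / B.energy\<^sup>2"
    using A.I_S1_eq B.I_S1_eq card(2,3) by simp_all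
  have pos: "A.energy > 0" "B.energy > 0" "real (card (parcs D')) > 0"
    using A.energy_pos B.energy_pos card(2,3) by simp_all
  have "A.energy \<le> B.energy"
    unfolding A.energy_def B.energy_def by (rule sum_mset_le_if_prod_le(1)[OF nn size prod])
  then have "A.energy\<^sup>2 \<le> B.energy\<^sup>2" using pos(1) by (intro power_mono) auto
  then show "I_S1 vs D \<le> I_S1 vs' D'"
    unfolding I using pos by (intro diff_left_mono divide_left_mono mult_pos_pos) auto
  show "I_S1 vs D < I_S1 vs' D'"
    if less: "\<And>t. t > 0 \<Longrightarrow> skew_weights.char_det (skew_entry D) t (pverts D)
                       < skew_weights.char_det (skew_entry D') t (pverts D')"
  proof -
    have prod': "(\<Prod>a\<in>#?A. t\<^sup>2 + a\<^sup>2) < (\<Prod>b\<in>#?B. t\<^sup>2 + b\<^sup>2)" if "t > 0" for t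
      unfolding A.char_det_square[OF that, symmetric] B.char_det_square[OF that, symmetric]
      using less[OF that] nonneg[OF that] by (intro power_strict_mono) auto
    have "A.energy < B.energy"
      unfolding A.energy_def B.energy_def by (rule sum_mset_le_if_prod_le(2)[OF nn size prod prod'])
    then have "A.energy\<^sup>2 < B.energy\<^sup>2" using pos(1) by (intro power_strict_mono) auto
    then show ?thesis
      unfolding I using pos by (intro diff_strict_left_mono divide_strict_left_mono mult_pos_pos) auto
  qed
qed

context numbered_oriented_graph
begin

lemma forest_on_if_undirected_tree:
  assumes "undirected_tree (underlying D)"
  shows "forest_on weights.adj (pverts D)"
proof (rule ccontr)
  let ?U = "underlying D"
  assume "\<not> forest_on weights.adj (pverts D)"
  then obtain W where W: "W \<subseteq> pverts ?U" "W \<noteq> {}"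
    "\<forall>v\<in>W. \<exists>x\<in>W. \<exists>y\<in>W. (v, x) \<in> parcs ?U \<and> (v, y) \<in> parcs ?U \<and> x \<noteq> y"
    unfolding forest_on_def adj_eq by auto
  have "\<exists>p. pre_digraph.cycle (with_proj ?U) p \<and> length p \<ge> 3"
  proof (rule cycle_if_min_degree_2[OF _ _ _ _ W])
    show "(y, x) \<in> parcs ?U" if "(x, y) \<in> parcs ?U" for x y
      using that weights.sym adj_iff by blast
    show "(x, x) \<notin> parcs ?U" for x using weights.irrefl adj_iff by blast
  qed (use parcs_underlying_subset finite_verts_D in simp_all)
  then show False using assms unfolding undirected_tree_def by blast
qed

lemma connected_on_if_undirected_tree:
  assumes "undirected_tree (underlying D)"
  shows "connected_on weights.adj (pverts D)" "pverts D \<noteq> {}"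
proof -
  have con: "Digraph_Component.connected (with_proj (underlying D))"
    using assms unfolding undirected_tree_def by blast
  have "connected_on (\<lambda>x y. (x, y) \<in> parcs (underlying D)) (pverts (underlying D))"
    using con parcs_underlying_subset weights.sym adj_iff by (intro connected_on_if_connected) auto
  then show "connected_on weights.adj (pverts D)" by (simp add: adj_eq)
  show "pverts D \<noteq> {}"
    using con by (auto simp: Digraph_Component.connected_def strongly_connected_def)
qed

lemma star_on_if_iso:
  assumes "underlying D \<cong>\<^sub>G star_graph N"
  shows "star_on weights.adj (pverts D)" "card (pverts D) = N" "card (parcs D) = N - 1"
proof -
  obtain f where f: "bij_betw f (pverts D) {..<N}"
    "\<And>x y. x \<in> pverts D \<Longrightarrow> y \<in> pverts D \<Longrightarrow> weights.adj x y \<longleftrightarrow> (f x, f y) \<in> parcs (star_graph N)"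
    "card (parcs (underlying D)) = card (parcs (star_graph N))"
    using assms by (elim graph_isoE) (auto simp: star_graph_def adj_iff)
  show "card (pverts D) = N" using bij_betw_same_card[OF f(1)] by simp
  show "card (parcs D) = N - 1"
    using f(3) by (simp add: card_parcs_star_graph card_parcs_underlying)
  show "star_on weights.adj (pverts D)"
  proof (cases "\<exists>c\<in>pverts D. f c = 0")
    case True
    then obtain c where c: "c \<in> pverts D" "f c = 0" by blast
    have "x = c \<or> y = c" if "x \<in> pverts D" "y \<in> pverts D" "weights.adj x y" for x y
    proof -
      have "f x = f c \<or> f y = f c"
        using f(2)[OF that(1,2)] that(3) c(2) by (simp add: star_graph_def)
      then show ?thesis
        using bij_betw_imp_inj_on[OF f(1)] that c(1) by (auto dest: inj_onD)
    qed
    then show ?thesis unfolding star_on_def by blast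
  next
    case False
    then have "\<not> weights.adj x y" if "x \<in> pverts D" "y \<in> pverts D" for x y
      using f(2)[OF that] that by (auto simp: star_graph_def)
    then show ?thesis unfolding star_on_def by blast
  qed
qed

lemma iso_if_star_on:
  assumes star: "star_on weights.adj (pverts D)" and con: "connected_on weights.adj (pverts D)"
    and N: "card (pverts D) = N" "N \<ge> 2"
  shows "underlying D \<cong>\<^sub>G star_graph N"
proof -
  obtain c where c: "\<forall>x\<in>pverts D. \<forall>y\<in>pverts D. weights.adj x y \<longrightarrow> x = c \<or> y = c"
    using star unfolding star_on_def by blast
  have nbr: "\<exists>y\<in>pverts D. weights.adj x y" if "x \<in> pverts D" for x
  proof -
    have "{x} \<noteq> pverts D"
    proof
      assume "{x} = pverts D"
      then have "card {x} = card (pverts D)" by (simp only:)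
      then show False using N by simp
    qed
    then show ?thesis using con that unfolding connected_on_def by (metis DiffD1 empty_subsetI insert_not_empty insert_subset singletonD)
  qed
  obtain x where "x \<in> pverts D" using N by fastforce
  then have cV: "c \<in> pverts D" using nbr c by blast
  (* Connectedness rules out isolated vertices, so every other vertex is joined to c. *)
  have adj_c: "weights.adj x c" "weights.adj c x" if "x \<in> pverts D" "x \<noteq> c" for x
    using nbr[OF that(1)] c that weights.sym by blast+
  have "card (pverts D - {c}) = card {1..<N}" using N cV finite_verts_D by simp
  then obtain g where g: "bij_betw g (pverts D - {c}) {1..<N}"
    using finite_same_card_bij[of "pverts D - {c}" "{1..<N}"] finite_verts_D by auto
  define f where "f x = (if x = c then 0 else g x)" for x
  have f: "bij_betw f (pverts D) {..<N}"
  proof -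
    have "bij_betw f (pverts D - {c}) {1..<N}"
      using g by (rule bij_betw_cong[THEN iffD1, rotated]) (simp add: f_def)
    moreover have "bij_betw f {c} {0}" by (simp add: f_def bij_betw_def)
    ultimately have "bij_betw f ((pverts D - {c}) \<union> {c}) ({1..<N} \<union> {0})"
      by (rule bij_betw_combine) auto
    moreover have "(pverts D - {c}) \<union> {c} = pverts D" "{1..<N} \<union> {0} = {..<N}"
      using cV N(2) by auto
    ultimately show ?thesis by simp
  qed
  have f0: "f x = 0 \<longleftrightarrow> x = c" if "x \<in> pverts D" for x
  proof (cases "x = c")
    case False
    then have "g x \<in> {1..<N}" using g that by (intro bij_betwE[OF g, rule_format]) auto
    then show ?thesis using False by (simp add: f_def)
  qed (simp add: f_def)
  show ?thesis
  proof (rule graph_isoI)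
    show "bij_betw f (pverts (underlying D)) (pverts (star_graph N))"
      using f by (simp add: star_graph_def)
    fix x y assume "x \<in> pverts (underlying D)" "y \<in> pverts (underlying D)"
    then have xy: "x \<in> pverts D" "y \<in> pverts D" by simp_all
    have "weights.adj x y \<longleftrightarrow> x \<noteq> y \<and> (x = c \<or> y = c)"
      using c xy adj_c weights.irrefl by blast
    also have "\<dots> \<longleftrightarrow> f x \<noteq> f y \<and> (f x = 0 \<or> f y = 0)"
      using f0 xy by metis
    also have "\<dots> \<longleftrightarrow> (f x, f y) \<in> parcs (star_graph N)"
      using bij_betwE[OF f] xy by (simp add: star_graph_def)
    finally show "(x, y) \<in> parcs (underlying D) \<longleftrightarrow> (f x, f y) \<in> parcs (star_graph N)"
      by (simp add: adj_iff)
  next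
    show "parcs (underlying D) \<subseteq> pverts (underlying D) \<times> pverts (underlying D)"
      using parcs_underlying_subset by simp
    show "parcs (star_graph N) \<subseteq> pverts (star_graph N) \<times> pverts (star_graph N)"
      by (auto simp: star_graph_def)
  qed
qed

lemma induced_path_if_iso:
  assumes "underlying D \<cong>\<^sub>G path_graph N"
  shows "\<exists>xs. induced_path weights.adj xs \<and> set xs = pverts D" "card (pverts D) = N" "card (parcs D) = N - 1"
proof -
  obtain f where f: "bij_betw f (pverts D) {..<N}"
    "\<And>x y. x \<in> pverts D \<Longrightarrow> y \<in> pverts D \<Longrightarrow> weights.adj x y \<longleftrightarrow> (f x, f y) \<in> parcs (path_graph N)"
    "card (parcs (underlying D)) = card (parcs (path_graph N))"
    using assms by (elim graph_isoE) (auto simp: path_graph_def adj_iff)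
  show "card (pverts D) = N" using bij_betw_same_card[OF f(1)] by simp
  show "card (parcs D) = N - 1"
    using f(3) by (simp add: card_parcs_path_graph card_parcs_underlying)
  let ?g = "inv_into (pverts D) f"
  have g: "bij_betw ?g {..<N} (pverts D)" by (rule bij_betw_inv_into[OF f(1)])
  have fg: "f (?g i) = i" if "i < N" for i
    using bij_betw_inv_into_right[OF f(1)] that by simp
  have gV: "?g i \<in> pverts D" if "i < N" for i
    using bij_betwE[OF g] that by simp
  have "induced_path weights.adj (map ?g [0..<N])"
    unfolding induced_path_def
  proof (intro conjI allI impI)
    show "distinct (map ?g [0..<N])"
      using bij_betw_imp_inj_on[OF g] by (simp add: distinct_map atLeast0LessThan)
    fix i j assume ij: "i < length (map ?g [0..<N])" "j < length (map ?g [0..<N])"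
    then have "weights.adj (?g i) (?g j) \<longleftrightarrow> (i, j) \<in> parcs (path_graph N)"
      using f(2)[OF gV gV, of i j] by (simp add: fg)
    then show "weights.adj (map ?g [0..<N] ! i) (map ?g [0..<N] ! j) \<longleftrightarrow> j = Suc i \<or> i = Suc j"
      using ij by (simp add: path_graph_def)
  qed
  moreover have "set (map ?g [0..<N]) = pverts D"
    using bij_betw_imp_surj_on[OF g] by (simp add: atLeast0LessThan)
  ultimately show "\<exists>xs. induced_path weights.adj xs \<and> set xs = pverts D" by blast
qed

lemma iso_if_induced_path:
  assumes xs: "induced_path weights.adj xs" "set xs = pverts D" and N: "card (pverts D) = N"
  shows "underlying D \<cong>\<^sub>G path_graph N"
proof -
  have dist: "distinct xs" using xs(1) by (simp add: induced_path_def)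
  have len: "length xs = N" using distinct_card[OF dist] xs(2) N by simp
  have g: "bij_betw ((!) xs) {..<N} (pverts D)"
    using bij_betw_nth[OF dist, of "{..<N}" "pverts D"] len xs(2) by simp
  let ?f = "inv_into {..<N} ((!) xs)"
  have f: "bij_betw ?f (pverts D) {..<N}" by (rule bij_betw_inv_into[OF g])
  have gf: "xs ! ?f x = x" if "x \<in> pverts D" for x
    using bij_betw_inv_into_right[OF g that] .
  have fN: "?f x < N" if "x \<in> pverts D" for x
    using bij_betwE[OF f] that by simp
  show ?thesis
  proof (rule graph_isoI)
    show "bij_betw ?f (pverts (underlying D)) (pverts (path_graph N))"
      using f by (simp add: path_graph_def)
    fix x y assume "x \<in> pverts (underlying D)" "y \<in> pverts (underlying D)"
    then have xy: "x \<in> pverts D" "y \<in> pverts D" by simp_all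
    have "weights.adj (xs ! ?f x) (xs ! ?f y) \<longleftrightarrow> ?f y = Suc (?f x) \<or> ?f x = Suc (?f y)"
      using xs(1) fN[OF xy(1)] fN[OF xy(2)] len unfolding induced_path_def by blast
    then show "(x, y) \<in> parcs (underlying D) \<longleftrightarrow> (?f x, ?f y) \<in> parcs (path_graph N)"
      using fN[OF xy(1)] fN[OF xy(2)] by (simp add: gf xy adj_iff path_graph_def)
  next
    show "parcs (underlying D) \<subseteq> pverts (underlying D) \<times> pverts (underlying D)"
      using parcs_underlying_subset by simp
    show "parcs (path_graph N) \<subseteq> pverts (path_graph N) \<times> pverts (path_graph N)"
      by (auto simp: path_graph_def)
  qed
qed

end

text \<open>
  All three graphs have \<open>N - 1\<close> arcs, so the entropies compare as the energies do, and these compare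
  as the characteristic polynomials do. For a tree that is not a star (not a path) the pointwise
  comparison with the star (the path) is strict for every \<open>t > 0\<close>, hence so is that of the entropies.
\<close>

theorem I_S1_oriented_tree:
  assumes T: "numbered_oriented_graph T ts" and tree: "undirected_tree (underlying T)"
    and S: "numbered_oriented_graph S ss" and star: "underlying S \<cong>\<^sub>G star_graph N"
    and P: "numbered_oriented_graph P ps" and path: "underlying P \<cong>\<^sub>G path_graph N"
    and N: "card (pverts T) = N" "N \<ge> 2"
  shows "I_S1 ss S \<le> I_S1 ts T" "I_S1 ts T \<le> I_S1 ps P"
    "I_S1 ss S = I_S1 ts T \<longleftrightarrow> underlying T \<cong>\<^sub>G star_graph N"
    "I_S1 ts T = I_S1 ps P \<longleftrightarrow> underlying T \<cong>\<^sub>G path_graph N"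
proof -
  interpret T: numbered_oriented_graph T ts by (rule T)
  interpret S: numbered_oriented_graph S ss by (rule S)
  interpret P: numbered_oriented_graph P ps by (rule P)
  note forest = T.forest_on_if_undirected_tree[OF tree]
  note con = T.connected_on_if_undirected_tree[OF tree]
  have edges: "card (edge_pairs T.weights.adj (pverts T)) = 2 * (N - 1)"
    using T.weights.card_edge_pairs_tree[OF T.finite_verts_D forest con] N by simp
  then have arcs: "card (parcs T) = N - 1"
    using T.edge_pairs_eq T.card_parcs_underlying by simp
  note S_star = S.star_on_if_iso[OF star] and P_path = P.induced_path_if_iso[OF path]
  have S_edges: "card (edge_pairs S.weights.adj (pverts S)) = 2 * (N - 1)"
    using S_star(3) by (simp add: S.edge_pairs_eq S.card_parcs_underlying)
  have det_S: "t\<^sup>2 * S.weights.char_det t (pverts S) = t ^ N * (t\<^sup>2 + real (2 * (N - 1)) / 2)" for t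
    using S.weights.char_det_star[OF S.finite_verts_D S_star(1), of t] unfolding S_edges S_star(2) .
  note det_T = T.weights.char_det_forest_ge[OF _ T.finite_verts_D forest, unfolded edges N(1), folded det_S]
  have det_P: "P.weights.char_det t (pverts P) = path_char_poly t N" for t
  proof -
    obtain xs where xs: "induced_path P.weights.adj xs" "set xs = pverts P" using P_path(1) by blast
    then have "length xs = N"
      using P_path(2) distinct_card[of xs] by (simp add: induced_path_def)
    then show ?thesis using P.weights.char_det_induced_path[OF xs(1), of t] xs(2) by simp
  qed
  note det_T' = T.weights.char_det_forest_le[OF _ T.finite_verts_D forest, unfolded N(1), folded det_P]
  have S_nonneg: "0 \<le> S.weights.char_det t (pverts S)" if "t > 0" for t
  proof -
    have "0 \<le> t\<^sup>2 * S.weights.char_det t (pverts S)" unfolding det_S using that by simp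
    then show ?thesis using that by (simp add: zero_le_mult_iff)
  qed
  have ST: "S.weights.char_det t (pverts S) \<le> T.weights.char_det t (pverts T)" if "t > 0" for t
    using det_T(1)[OF that] that by simp
  have T_nonneg: "0 \<le> T.weights.char_det t (pverts T)" if "t > 0" for t
    using ST[OF that] S_nonneg[OF that] by simp
  note cmp_ST = I_S1_mono_char_det[OF S T _ _ _ S_nonneg ST]
  note cmp_TP = I_S1_mono_char_det[OF T P _ _ _ T_nonneg det_T'(1)]
  have cards: "card (pverts S) = card (pverts T)" "card (parcs S) = card (parcs T)" "card (parcs S) \<ge> 1"
      "card (pverts T) = card (pverts P)" "card (parcs T) = card (parcs P)" "card (parcs T) \<ge> 1"
    using S_star P_path N arcs by simp_all
  show 1: "I_S1 ss S \<le> I_S1 ts T" using cmp_ST(1) cards by blast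
  show 2: "I_S1 ts T \<le> I_S1 ps P" using cmp_TP(1) cards by blast
  show "I_S1 ss S = I_S1 ts T \<longleftrightarrow> underlying T \<cong>\<^sub>G star_graph N"
  proof
    assume "underlying T \<cong>\<^sub>G star_graph N"
    then have "star_on T.weights.adj (pverts T)" by (rule T.star_on_if_iso)
    then have eq: "t\<^sup>2 * T.weights.char_det t (pverts T) = t\<^sup>2 * S.weights.char_det t (pverts S)" for t
      using T.weights.char_det_star[OF T.finite_verts_D, of t] unfolding det_S edges N(1) by simp
    have "T.weights.char_det t (pverts T) \<le> S.weights.char_det t (pverts S)" if "t > 0" for t
      using eq[of t] that by simp
    then have "I_S1 ts T \<le> I_S1 ss S"
      using cards T_nonneg by (intro I_S1_mono_char_det(1)[OF T S]) auto
    then show "I_S1 ss S = I_S1 ts T" using 1 by simp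
  next
    assume eq: "I_S1 ss S = I_S1 ts T"
    have "star_on T.weights.adj (pverts T)"
    proof (rule ccontr)
      assume "\<not> star_on T.weights.adj (pverts T)"
      then have "S.weights.char_det t (pverts S) < T.weights.char_det t (pverts T)" if "t > 0" for t
        using det_T(2)[OF that] that by simp
      then have "I_S1 ss S < I_S1 ts T" using cmp_ST(2) cards by blast
      then show False using eq by simp
    qed
    then show "underlying T \<cong>\<^sub>G star_graph N" using con(1) N by (rule T.iso_if_star_on)
  qed
  show "I_S1 ts T = I_S1 ps P \<longleftrightarrow> underlying T \<cong>\<^sub>G path_graph N"
  proof
    assume iso: "underlying T \<cong>\<^sub>G path_graph N"
    obtain xs where xs: "induced_path T.weights.adj xs" "set xs = pverts T"
      using T.induced_path_if_iso(1)[OF iso] by blast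
    then have "length xs = N"
      using N(1) distinct_card[of xs] by (simp add: induced_path_def)
    then have "T.weights.char_det t (pverts T) = P.weights.char_det t (pverts P)" for t
      using T.weights.char_det_induced_path[OF xs(1), of t] xs(2) det_P by simp
    then have "I_S1 ps P \<le> I_S1 ts T"
      using cards T_nonneg by (intro I_S1_mono_char_det(1)[OF P T]) auto
    then show "I_S1 ts T = I_S1 ps P" using 2 by simp
  next
    assume eq: "I_S1 ts T = I_S1 ps P"
    have "\<exists>xs. induced_path T.weights.adj xs \<and> set xs = pverts T"
    proof (rule ccontr)
      assume "\<not> ?thesis"
      then have "T.weights.char_det t (pverts T) < P.weights.char_det t (pverts P)" if "t > 0" for t
        using det_T'[OF that] by (meson order_le_less)
      then have "I_S1 ts T < I_S1 ps P" using cmp_TP(2) cards by blast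
      then show False using eq by simp
    qed
    then show "underlying T \<cong>\<^sub>G path_graph N" using T.iso_if_induced_path N(1) by blast
  qed
qed

theorem corollary3p10:
  fixes D :: "'a pair_pre_digraph" and ds :: "'a list"
    and T :: "'b pair_pre_digraph" and ts :: "'b list"
    and S :: "'c pair_pre_digraph" and ss :: "'c list"
    and P :: "'d pair_pre_digraph" and ps :: "'d list"
    and n m \<Delta> N :: nat
  shows
    "(oriented_graph D \<and> vertex_numbering ds D \<and> card (pverts D) = n \<and>
        card (parcs D) = m \<and> m \<ge> 1 \<and> max_degree (underlying D) = \<Delta> \<longrightarrow>
        1 - 2 * real m /
              (2 * real m + real n * (real n - 1) * cmod (det (skew_adj_mat ds D)) powr (2 / real n))
          \<le> I_S1 ds D \<and>
        I_S1 ds D \<le> 1 - 1 / real n \<and>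
        1 - 1 / real n \<le> 1 - 2 * real m / (real n ^ 2 * real \<Delta>))
     \<and>
     (N \<ge> 2 \<and>
        oriented_graph T \<and> vertex_numbering ts T \<and> card (pverts T) = N \<and>
        undirected_tree (underlying T) \<and>
        oriented_graph S \<and> vertex_numbering ss S \<and> underlying S \<cong>\<^sub>G star_graph N \<and>
        oriented_graph P \<and> vertex_numbering ps P \<and> underlying P \<cong>\<^sub>G path_graph N \<longrightarrow>
        I_S1 ss S \<le> I_S1 ts T \<and>
        I_S1 ts T \<le> I_S1 ps P \<and>
        (I_S1 ss S = I_S1 ts T \<or> I_S1 ts T = I_S1 ps P \<longleftrightarrow>
           underlying T \<cong>\<^sub>G star_graph N \<or> underlying T \<cong>\<^sub>G path_graph N))"
proof (rule conjI; intro impI; elim conjE)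
  assume "oriented_graph D" "vertex_numbering ds D" and n: "card (pverts D) = n"
    and m: "card (parcs D) = m" "m \<ge> 1" and \<Delta>: "max_degree (underlying D) = \<Delta>"
  then interpret numbered_oriented_graph D ds
    by (simp add: numbered_oriented_graph_def numbered_oriented_graph_axioms_def)
  show "1 - 2 * real m /
              (2 * real m + real n * (real n - 1) * cmod (det (skew_adj_mat ds D)) powr (2 / real n))
          \<le> I_S1 ds D \<and>
        I_S1 ds D \<le> 1 - 1 / real n \<and>
        1 - 1 / real n \<le> 1 - 2 * real m / (real n ^ 2 * real \<Delta>)"
    using I_S1_bounds[unfolded n m(1) \<Delta>, OF m(2)] by blast
next
  assume N: "card (pverts T) = N" "N \<ge> 2" and tree: "undirected_tree (underlying T)"
    and star: "underlying S \<cong>\<^sub>G star_graph N" and path: "underlying P \<cong>\<^sub>G path_graph N"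
    and "oriented_graph T" "vertex_numbering ts T" "oriented_graph S" "vertex_numbering ss S"
      "oriented_graph P" "vertex_numbering ps P"
  then have "numbered_oriented_graph T ts" "numbered_oriented_graph S ss" "numbered_oriented_graph P ps"
    by (simp_all add: numbered_oriented_graph_def numbered_oriented_graph_axioms_def)
  note extremal = I_S1_oriented_tree[OF this(1) tree this(2) star this(3) path N]
  then show "I_S1 ss S \<le> I_S1 ts T \<and> I_S1 ts T \<le> I_S1 ps P \<and>
        (I_S1 ss S = I_S1 ts T \<or> I_S1 ts T = I_S1 ps P \<longleftrightarrow>
           underlying T \<cong>\<^sub>G star_graph N \<or> underlying T \<cong>\<^sub>G path_graph N)"
    by simp
qed

end
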